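(* The category $\mathbf{DCA}_{trivial}$ of trivial dynamic contact algebras with DCA-morphisms is dually equivalent to the category $\mathbf{DMS}^*_{trivial}$ of trivial $T_0$ and DM-compact dynamic mereotopological spaces with DMS-morphisms.
   Context: DCA: $(B,C^s,C^t,\mathcal{B})$, Boolean algebra $0\neq1$, contact relations $C^s,C^t$, precontact $\mathcal{B}$ (precontact: $aCb\Rightarrow a,b\neq0$, upward monotone, additive in each argument; contact: also symmetric and $a\cdot b\neq0\Rightarrow aCb$), with $aC^sb\Rightarrow aC^tb$, $a\overline{C^t}b\Rightarrow\exists c(a\overline{C^t}c\wedge c^*\overline{C^t}b)$, $a\overline{\mathcal{B}}b\Rightarrow\exists c(a\overline{C^t}c\wedge c^*\overline{\mathcal{B}}b)$, $a\overline{\mathcal{B}}b\Rightarrow\exists c(a\overline{\mathcal{B}}c\wedge c^*\overline{C^t}b)$. A DCA is trivial if $a\neq0,b\neq0$ imply $aC^tb$ and $a\mathcal{B}b$. DCA-morphism: Boolean homomorphism $f$ with $f(a)Rf(b)\Rightarrow aRb$ for $R=C^s,C^t,\mathcal{B}$. DMS $S=(X^t,X^s,T,\prec,M)$: $X^t$ a nonempty space; $M$ a Boolean subalgebra of the regular closed sets forming a closed base; $X^s,T\subseteq X^t$ nonempty; each nonempty regular closed set meets $X^s$; $\prec$ on $X^t$; $aC^tb$ iff $a\cap b\neq\emptyset$, $aC^sb$ iff $a\cap b\cap X^s\neq\emptyset$, $a\mathcal{B}b$ iff $\exists x\in a,y\in b\,x\prec y$; $S^+=(M,C^s,C^t,\mathcal{B})$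 must be a DCA; $x\prec y$ iff $\forall a,b\in M(x\in a,y\in b\Rightarrow a\mathcal{B}b)$; $\rho_S(x)=\{a\in M:x\in a\}$ is a cluster for $x\in T$. t-clans/s-clans: $\Gamma$ with $1\in\Gamma,0\notin\Gamma$, upward closed, prime, pairwise $C^t$-/$C^s$-related; clusters: t-clans with $\forall a\notin\Gamma\exists b\in\Gamma\,a\overline{C^t}b$. $T_0$: $X^t$ is $T_0$; DM-compact: every t-clan, s-clan, cluster of $S^+$ is $\rho_S(x)$ for some $x$ in $X^t$, $X^s$, $T$ resp. A DMS is trivial if $T=\{t_0\}$ is a singleton and $t_0\prec t_0$. DMS-morphism $\theta:X^t_1\to X^t_2$: $\theta(X^s_1)\subseteq X^s_2$, preserves $\prec$, $\theta^{-1}$ maps $M_2$ into $M_1$ and is a Boolean homomorphism there. *)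

theory Defs
  imports "HOL-Analysis.Abstract_Topological_Spaces" "HOL-Library.Equipollence" "HOL-Library.FuncSet"
begin

section \<open>Categories and dual equivalence\<close>

text \<open>Hom-sets are indexed by pairs of objects and need not be disjoint; identities, composition
  and functors therefore take the objects involved as arguments.
  \<open>Comp C X Y Z g f\<close> is \<open>g \<circ> f : X \<rightarrow> Y \<rightarrow> Z\<close>.\<close>

record ('o, 'm) cat =
  Ob :: "'o set"
  Hom :: "'o \<Rightarrow> 'o \<Rightarrow> 'm set"
  Idm :: "'o \<Rightarrow> 'm"
  Comp :: "'o \<Rightarrow> 'o \<Rightarrow> 'o \<Rightarrow> 'm \<Rightarrow> 'm \<Rightarrow> 'm"

definition is_category :: "('o, 'm) cat \<Rightarrow> bool" where
  "is_category C \<longleftrightarrow>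
    (\<forall>X\<in>Ob C. Idm C X \<in> Hom C X X) \<and>
    (\<forall>X\<in>Ob C. \<forall>Y\<in>Ob C. \<forall>Z\<in>Ob C. \<forall>f\<in>Hom C X Y. \<forall>g\<in>Hom C Y Z. Comp C X Y Z g f \<in> Hom C X Z) \<and>
    (\<forall>X\<in>Ob C. \<forall>Y\<in>Ob C. \<forall>f\<in>Hom C X Y.
       Comp C X X Y f (Idm C X) = f \<and> Comp C X Y Y (Idm C Y) f = f) \<and>
    (\<forall>W\<in>Ob C. \<forall>X\<in>Ob C. \<forall>Y\<in>Ob C. \<forall>Z\<in>Ob C. \<forall>f\<in>Hom C W X. \<forall>g\<in>Hom C X Y. \<forall>h\<in>Hom C Y Z.
       Comp C W Y Z h (Comp C W X Y g f) = Comp C W X Z (Comp C X Y Z h g) f)"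

definition opposite :: "('o, 'm) cat \<Rightarrow> ('o, 'm) cat" where
  "opposite C = \<lparr>Ob = Ob C, Hom = (\<lambda>X Y. Hom C Y X), Idm = Idm C,
                 Comp = (\<lambda>X Y Z g f. Comp C Z Y X f g)\<rparr>"

record ('o1, 'm1, 'o2, 'm2) fctr =
  obj_map :: "'o1 \<Rightarrow> 'o2"
  mor_map :: "'o1 \<Rightarrow> 'o1 \<Rightarrow> 'm1 \<Rightarrow> 'm2"

definition is_functor ::
  "('o1, 'm1) cat \<Rightarrow> ('o2, 'm2) cat \<Rightarrow> ('o1, 'm1, 'o2, 'm2) fctr \<Rightarrow> bool" where
  "is_functor C D F \<longleftrightarrow>
    (\<forall>X\<in>Ob C. obj_map F X \<in> Ob D) \<and>
    (\<forall>X\<in>Ob C. \<forall>Y\<in>Ob C. \<forall>f\<in>Hom C X Y. mor_map F X Y f \<in> Hom D (obj_map F X) (obj_map F Y)) \<and>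
    (\<forall>X\<in>Ob C. mor_map F X X (Idm C X) = Idm D (obj_map F X)) \<and>
    (\<forall>X\<in>Ob C. \<forall>Y\<in>Ob C. \<forall>Z\<in>Ob C. \<forall>f\<in>Hom C X Y. \<forall>g\<in>Hom C Y Z.
       mor_map F X Z (Comp C X Y Z g f) =
       Comp D (obj_map F X) (obj_map F Y) (obj_map F Z) (mor_map F Y Z g) (mor_map F X Y f))"

definition id_fctr :: "('o, 'm, 'o, 'm) fctr" where
  "id_fctr = \<lparr>obj_map = (\<lambda>X. X), mor_map = (\<lambda>X Y f. f)\<rparr>"

definition comp_fctr ::
  "('o2, 'm2, 'o3, 'm3) fctr \<Rightarrow> ('o1, 'm1, 'o2, 'm2) fctr \<Rightarrow> ('o1, 'm1, 'o3, 'm3) fctr" where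
  "comp_fctr G F = \<lparr>obj_map = (\<lambda>X. obj_map G (obj_map F X)),
     mor_map = (\<lambda>X Y f. mor_map G (obj_map F X) (obj_map F Y) (mor_map F X Y f))\<rparr>"

definition is_iso :: "('o, 'm) cat \<Rightarrow> 'o \<Rightarrow> 'o \<Rightarrow> 'm \<Rightarrow> bool" where
  "is_iso C X Y f \<longleftrightarrow> f \<in> Hom C X Y \<and>
    (\<exists>g\<in>Hom C Y X. Comp C X Y X g f = Idm C X \<and> Comp C Y X Y f g = Idm C Y)"

definition naturally_isomorphic ::
  "('o1, 'm1) cat \<Rightarrow> ('o2, 'm2) cat \<Rightarrow>
   ('o1, 'm1, 'o2, 'm2) fctr \<Rightarrow> ('o1, 'm1, 'o2, 'm2) fctr \<Rightarrow> bool" where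
  "naturally_isomorphic C D F G \<longleftrightarrow> (\<exists>\<eta>.
    (\<forall>X\<in>Ob C. is_iso D (obj_map F X) (obj_map G X) (\<eta> X)) \<and>
    (\<forall>X\<in>Ob C. \<forall>Y\<in>Ob C. \<forall>f\<in>Hom C X Y.
       Comp D (obj_map F X) (obj_map F Y) (obj_map G Y) (\<eta> Y) (mor_map F X Y f) =
       Comp D (obj_map F X) (obj_map G X) (obj_map G Y) (mor_map G X Y f) (\<eta> X)))"

definition equivalent_categories :: "('o1, 'm1) cat \<Rightarrow> ('o2, 'm2) cat \<Rightarrow> bool" where
  "equivalent_categories C D \<longleftrightarrow> is_category C \<and> is_category D \<and>
    (\<exists>F G. is_functor C D F \<and> is_functor D C G \<and>
       naturally_isomorphic C C id_fctr (comp_fctr G F) \<and>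
       naturally_isomorphic D D id_fctr (comp_fctr F G))"

definition dually_equivalent :: "('o1, 'm1) cat \<Rightarrow> ('o2, 'm2) cat \<Rightarrow> bool" where
  "dually_equivalent C D \<longleftrightarrow> equivalent_categories C (opposite D)"


section \<open>Dynamic contact algebras\<close>

text \<open>The library's Boolean algebras live on a whole type; here the carrier is a set, since the
  dual algebra of a space is a family of regular closed sets. The axioms are those of
  \<open>abstract_boolean_algebra\<close>, relativised to the carrier.\<close>

record 'a boolalg =
  elems :: "'a set"
  join :: "'a \<Rightarrow> 'a \<Rightarrow> 'a"
  meet :: "'a \<Rightarrow> 'a \<Rightarrow> 'a"
  cmpl :: "'a \<Rightarrow> 'a"
  bzero :: 'a
  bone :: 'a

record 'a dca = "'a boolalg" +
  Cs :: "'a \<Rightarrow> 'a \<Rightarrow> bool"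
  Ct :: "'a \<Rightarrow> 'a \<Rightarrow> bool"
  Bp :: "'a \<Rightarrow> 'a \<Rightarrow> bool"

definition boolean_alg :: "('a, 'm) boolalg_scheme \<Rightarrow> bool" where
  "boolean_alg B \<longleftrightarrow>
    bzero B \<in> elems B \<and> bone B \<in> elems B \<and> bzero B \<noteq> bone B \<and>
    (\<forall>x\<in>elems B. cmpl B x \<in> elems B \<and>
       meet B x (bone B) = x \<and> join B x (bzero B) = x \<and>
       meet B x (cmpl B x) = bzero B \<and> join B x (cmpl B x) = bone B) \<and>
    (\<forall>x\<in>elems B. \<forall>y\<in>elems B. join B x y \<in> elems B \<and> meet B x y \<in> elems B \<and>
       join B x y = join B y x \<and> meet B x y = meet B y x) \<and>
    (\<forall>x\<in>elems B. \<forall>y\<in>elems B. \<forall>z\<in>elems B.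
       join B (join B x y) z = join B x (join B y z) \<and>
       meet B (meet B x y) z = meet B x (meet B y z) \<and>
       meet B x (join B y z) = join B (meet B x y) (meet B x z) \<and>
       join B x (meet B y z) = meet B (join B x y) (join B x z))"

definition leq :: "('a, 'm) boolalg_scheme \<Rightarrow> 'a \<Rightarrow> 'a \<Rightarrow> bool" where
  "leq B x y \<longleftrightarrow> join B x y = y"

definition precontact :: "('a, 'm) boolalg_scheme \<Rightarrow> ('a \<Rightarrow> 'a \<Rightarrow> bool) \<Rightarrow> bool" where
  "precontact B R \<longleftrightarrow>
    (\<forall>a b. R a b \<longrightarrow> a \<in> elems B \<and> b \<in> elems B \<and> a \<noteq> bzero B \<and> b \<noteq> bzero B) \<and>
    (\<forall>a\<in>elems B. \<forall>b\<in>elems B. \<forall>a'\<in>elems B. \<forall>b'\<in>elems B.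
       R a b \<and> leq B a a' \<and> leq B b b' \<longrightarrow> R a' b') \<and>
    (\<forall>a\<in>elems B. \<forall>b\<in>elems B. \<forall>c\<in>elems B.
       (R a (join B b c) \<longrightarrow> R a b \<or> R a c) \<and>
       (R (join B a b) c \<longrightarrow> R a c \<or> R b c))"

definition contact :: "('a, 'm) boolalg_scheme \<Rightarrow> ('a \<Rightarrow> 'a \<Rightarrow> bool) \<Rightarrow> bool" where
  "contact B R \<longleftrightarrow> precontact B R \<and>
    (\<forall>a\<in>elems B. \<forall>b\<in>elems B. R a b \<longrightarrow> R b a) \<and>
    (\<forall>a\<in>elems B. \<forall>b\<in>elems B. meet B a b \<noteq> bzero B \<longrightarrow> R a b)"

definition is_dca :: "'a dca \<Rightarrow> bool" where
  "is_dca B \<longleftrightarrow> boolean_alg B \<and> contact B (Cs B) \<and> contact B (Ct B) \<and> precontact B (Bp B) \<and>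
    (\<forall>a\<in>elems B. \<forall>b\<in>elems B.
       (Cs B a b \<longrightarrow> Ct B a b) \<and>
       (\<not> Ct B a b \<longrightarrow> (\<exists>c\<in>elems B. \<not> Ct B a c \<and> \<not> Ct B (cmpl B c) b)) \<and>
       (\<not> Bp B a b \<longrightarrow> (\<exists>c\<in>elems B. \<not> Ct B a c \<and> \<not> Bp B (cmpl B c) b)) \<and>
       (\<not> Bp B a b \<longrightarrow> (\<exists>c\<in>elems B. \<not> Bp B a c \<and> \<not> Ct B (cmpl B c) b)))"

definition trivial_dca :: "'a dca \<Rightarrow> bool" where
  "trivial_dca B \<longleftrightarrow> is_dca B \<and>
    (\<forall>a\<in>elems B. \<forall>b\<in>elems B. a \<noteq> bzero B \<and> b \<noteq> bzero B \<longrightarrow> Ct B a b \<and> Bp B a b)"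

text \<open>Homomorphisms are extensional functions on the carrier, so that equality of morphisms is
  equality of their values on the carrier.\<close>

definition boolean_hom ::
  "('a, 'm) boolalg_scheme \<Rightarrow> ('b, 'n) boolalg_scheme \<Rightarrow> ('a \<Rightarrow> 'b) \<Rightarrow> bool" where
  "boolean_hom A B f \<longleftrightarrow> f \<in> elems A \<rightarrow>\<^sub>E elems B \<and>
    f (bzero A) = bzero B \<and> f (bone A) = bone B \<and>
    (\<forall>x\<in>elems A. f (cmpl A x) = cmpl B (f x)) \<and>
    (\<forall>x\<in>elems A. \<forall>y\<in>elems A.
       f (join A x y) = join B (f x) (f y) \<and> f (meet A x y) = meet B (f x) (f y))"

definition dca_morphism :: "'a dca \<Rightarrow> 'b dca \<Rightarrow> ('a \<Rightarrow> 'b) \<Rightarrow> bool" where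
  "dca_morphism A B f \<longleftrightarrow> boolean_hom A B f \<and>
    (\<forall>a\<in>elems A. \<forall>b\<in>elems A.
       (Cs B (f a) (f b) \<longrightarrow> Cs A a b) \<and>
       (Ct B (f a) (f b) \<longrightarrow> Ct A a b) \<and>
       (Bp B (f a) (f b) \<longrightarrow> Bp A a b))"

definition clan :: "('a, 'm) boolalg_scheme \<Rightarrow> ('a \<Rightarrow> 'a \<Rightarrow> bool) \<Rightarrow> 'a set \<Rightarrow> bool" where
  "clan B R \<Gamma> \<longleftrightarrow> \<Gamma> \<subseteq> elems B \<and> bone B \<in> \<Gamma> \<and> bzero B \<notin> \<Gamma> \<and>
    (\<forall>a\<in>\<Gamma>. \<forall>b\<in>elems B. leq B a b \<longrightarrow> b \<in> \<Gamma>) \<and>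
    (\<forall>a\<in>elems B. \<forall>b\<in>elems B. join B a b \<in> \<Gamma> \<longrightarrow> a \<in> \<Gamma> \<or> b \<in> \<Gamma>) \<and>
    (\<forall>a\<in>\<Gamma>. \<forall>b\<in>\<Gamma>. R a b)"

definition t_clan :: "'a dca \<Rightarrow> 'a set \<Rightarrow> bool" where
  "t_clan B \<Gamma> \<longleftrightarrow> clan B (Ct B) \<Gamma>"

definition s_clan :: "'a dca \<Rightarrow> 'a set \<Rightarrow> bool" where
  "s_clan B \<Gamma> \<longleftrightarrow> clan B (Cs B) \<Gamma>"

definition cluster :: "'a dca \<Rightarrow> 'a set \<Rightarrow> bool" where
  "cluster B \<Gamma> \<longleftrightarrow> t_clan B \<Gamma> \<and> (\<forall>a\<in>elems B. a \<notin> \<Gamma> \<longrightarrow> (\<exists>b\<in>\<Gamma>. \<not> Ct B a b))"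


section \<open>Dynamic mereotopological spaces\<close>

record 'x dms =
  Xt :: "'x topology"
  Xs :: "'x set"
  Tm :: "'x set"
  prec :: "'x \<Rightarrow> 'x \<Rightarrow> bool"
  Ms :: "'x set set"

definition regular_closed :: "'x topology \<Rightarrow> 'x set \<Rightarrow> bool" where
  "regular_closed X a \<longleftrightarrow> a \<subseteq> topspace X \<and> X closure_of (X interior_of a) = a"

definition rc_meet :: "'x topology \<Rightarrow> 'x set \<Rightarrow> 'x set \<Rightarrow> 'x set" where
  "rc_meet X a b = X closure_of (X interior_of (a \<inter> b))"

definition rc_cmpl :: "'x topology \<Rightarrow> 'x set \<Rightarrow> 'x set" where
  "rc_cmpl X a = X closure_of (topspace X - a)"

definition rc_subalgebra :: "'x topology \<Rightarrow> 'x set set \<Rightarrow> bool" where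
  "rc_subalgebra X M \<longleftrightarrow> (\<forall>a\<in>M. regular_closed X a) \<and> {} \<in> M \<and> topspace X \<in> M \<and>
    (\<forall>a\<in>M. rc_cmpl X a \<in> M) \<and> (\<forall>a\<in>M. \<forall>b\<in>M. a \<union> b \<in> M \<and> rc_meet X a b \<in> M)"

definition closed_base :: "'x topology \<Rightarrow> 'x set set \<Rightarrow> bool" where
  "closed_base X M \<longleftrightarrow> (\<forall>a\<in>M. closedin X a) \<and>
    (\<forall>F. closedin X F \<longrightarrow> (\<exists>N\<subseteq>M. F = topspace X \<inter> \<Inter>N))"

text \<open>The algebra of a space, usually written with a superscript plus.\<close>

definition dual_dca :: "'x dms \<Rightarrow> 'x set dca" where
  "dual_dca S = \<lparr>elems = Ms S, join = (\<union>), meet = rc_meet (Xt S), cmpl = rc_cmpl (Xt S),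
     bzero = {}, bone = topspace (Xt S),
     Cs = (\<lambda>a b. a \<in> Ms S \<and> b \<in> Ms S \<and> a \<inter> b \<inter> Xs S \<noteq> {}),
     Ct = (\<lambda>a b. a \<in> Ms S \<and> b \<in> Ms S \<and> a \<inter> b \<noteq> {}),
     Bp = (\<lambda>a b. a \<in> Ms S \<and> b \<in> Ms S \<and> (\<exists>x\<in>a. \<exists>y\<in>b. prec S x y))\<rparr>"

definition rho :: "'x dms \<Rightarrow> 'x \<Rightarrow> 'x set set" where
  "rho S x = {a \<in> Ms S. x \<in> a}"

definition is_dms :: "'x dms \<Rightarrow> bool" where
  "is_dms S \<longleftrightarrow>
    topspace (Xt S) \<noteq> {} \<and>
    rc_subalgebra (Xt S) (Ms S) \<and> closed_base (Xt S) (Ms S) \<and>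
    Xs S \<noteq> {} \<and> Xs S \<subseteq> topspace (Xt S) \<and>
    Tm S \<noteq> {} \<and> Tm S \<subseteq> topspace (Xt S) \<and>
    (\<forall>a. regular_closed (Xt S) a \<and> a \<noteq> {} \<longrightarrow> a \<inter> Xs S \<noteq> {}) \<and>
    (\<forall>x y. prec S x y \<longrightarrow> x \<in> topspace (Xt S) \<and> y \<in> topspace (Xt S)) \<and>
    is_dca (dual_dca S) \<and>
    (\<forall>x\<in>topspace (Xt S). \<forall>y\<in>topspace (Xt S).
       prec S x y \<longleftrightarrow> (\<forall>a\<in>Ms S. \<forall>b\<in>Ms S. x \<in> a \<and> y \<in> b \<longrightarrow> Bp (dual_dca S) a b)) \<and>
    (\<forall>x\<in>Tm S. cluster (dual_dca S) (rho S x))"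

definition dm_compact :: "'x dms \<Rightarrow> bool" where
  "dm_compact S \<longleftrightarrow>
    (\<forall>\<Gamma>. t_clan (dual_dca S) \<Gamma> \<longrightarrow> (\<exists>x\<in>topspace (Xt S). \<Gamma> = rho S x)) \<and>
    (\<forall>\<Gamma>. s_clan (dual_dca S) \<Gamma> \<longrightarrow> (\<exists>x\<in>Xs S. \<Gamma> = rho S x)) \<and>
    (\<forall>\<Gamma>. cluster (dual_dca S) \<Gamma> \<longrightarrow> (\<exists>x\<in>Tm S. \<Gamma> = rho S x))"

definition trivial_dms :: "'x dms \<Rightarrow> bool" where
  "trivial_dms S \<longleftrightarrow> is_dms S \<and> (\<exists>t0. Tm S = {t0} \<and> prec S t0 t0)"

definition dms_morphism :: "'x dms \<Rightarrow> 'y dms \<Rightarrow> ('x \<Rightarrow> 'y) \<Rightarrow> bool" where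
  "dms_morphism S1 S2 \<theta> \<longleftrightarrow>
    \<theta> \<in> topspace (Xt S1) \<rightarrow>\<^sub>E topspace (Xt S2) \<and>
    \<theta> ` Xs S1 \<subseteq> Xs S2 \<and>
    (\<forall>x\<in>topspace (Xt S1). \<forall>y\<in>topspace (Xt S1). prec S1 x y \<longrightarrow> prec S2 (\<theta> x) (\<theta> y)) \<and>
    boolean_hom (dual_dca S2) (dual_dca S1) (\<lambda>a\<in>Ms S2. \<theta> -` a \<inter> topspace (Xt S1))"


section \<open>The two categories\<close>

text \<open>HOL has no category of all algebras of arbitrary size, so the size of the objects is a
  parameter: \<open>K\<close> is any family of sets, the admissible carriers of algebras. A space is of
  matching size if its algebra \<open>Ms\<close> is equinumerous with a member of \<open>K\<close>. If \<open>K\<close>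
  is the set of all sets of elements of \<open>'a\<close>, the algebras are, up to isomorphism, those
  with at most as many elements as \<open>'a\<close>. If \<open>'a\<close> is a universe and \<open>K\<close> its small
  subsets, one obtains the category of all small algebras; spaces that are \<open>T\<^sub>0\<close> and
  have small \<open>Ms\<close> are themselves small.\<close>

definition DCA_trivial :: "'a set set \<Rightarrow> ('a dca, 'a \<Rightarrow> 'a) cat" where
  "DCA_trivial K = \<lparr>
     Ob = {B. trivial_dca B \<and> elems B \<in> K},
     Hom = (\<lambda>A B. {f. dca_morphism A B f}),
     Idm = (\<lambda>A. \<lambda>x\<in>elems A. x),
     Comp = (\<lambda>A B C g f. compose (elems A) g f)\<rparr>"

definition DMS_star_trivial :: "'a set set \<Rightarrow> ('x dms, 'x \<Rightarrow> 'x) cat" where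
  "DMS_star_trivial K = \<lparr>
     Ob = {S. trivial_dms S \<and> t0_space (Xt S) \<and> dm_compact S \<and> (\<exists>A\<in>K. Ms S \<approx> A)},
     Hom = (\<lambda>S1 S2. {\<theta>. dms_morphism S1 S2 \<theta>}),
     Idm = (\<lambda>S. \<lambda>x\<in>topspace (Xt S). x),
     Comp = (\<lambda>S1 S2 S3 g f. compose (topspace (Xt S1)) g f)\<rparr>"

end

theory Submission
  imports Defs
begin

text \<open>A DMS-morphism \<open>\<theta>\<close> induces the preimage map between the dual algebras in the opposite
  direction. On \<open>T\<^sub>0\<close> DM-compact spaces this functor is fully faithful: a DCA-morphism
  \<open>f\<close> reflects contact, so it pulls the t-clan \<open>\<rho>(x)\<close> back to a t-clan, which is \<open>\<rho>(y)\<close> for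
  exactly one point \<open>y =: \<theta>(x)\<close>. It is essentially surjective because every trivial algebra is
  represented on the space of its t-clans, with the sets \<open>h(a) = {\<Gamma>. a \<in> \<Gamma>}\<close> as closed base.
  Triviality matches on both sides: in a trivial algebra the nonzero elements form the only
  cluster. Conversely, if \<open>t\<^sub>0\<close> is the only time point of a DM-compact space, then every nonzero element
  lies in an ultrafilter, hence in a cluster, which must be \<open>\<rho>(t\<^sub>0)\<close>; so any two nonzero
  elements meet in \<open>t\<^sub>0\<close>, and \<open>t\<^sub>0 \<prec> t\<^sub>0\<close> relates them.\<close>

section \<open>Equivalences from fully faithful, essentially surjective functors\<close>

text \<open>Size is the obstacle. A functor from algebras to spaces would need, for every algebra, a
  naming of its t-clans by points of type \<open>'x\<close>. The functor built here goes from spaces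
  to algebras, where only a bijection of \<open>Ms S\<close> with a member of \<open>K\<close> is
  chosen; the quasi-inverse comes from the abstract criterion by choice. T-clans are subsets of the
  carrier, so it is enough that the power set of each admissible carrier embeds into
  \<open>'x\<close>. Points are clans and not ultrafilters because contact of two disjoint regions
  must be witnessed by a common point, while no proper filter contains two elements with meet zero.
  In a trivial algebra the one cluster witnesses every instance of \<open>Ct\<close>, so a clan has
  to be constructed for a given pair only in the case of \<open>Cs\<close>.\<close>

lemma is_category_opposite:
  assumes "is_category C"
  shows "is_category (opposite C)"
  using assms unfolding is_category_def opposite_def by simp

lemma equivalent_categories_sym:
  "equivalent_categories C D \<Longrightarrow> equivalent_categories D C"
  unfolding equivalent_categories_def by blast

locale ff_ess_surj =
  fixes C :: "('o1, 'm1) cat" and D :: "('o2, 'm2) cat" and F :: "('o1, 'm1, 'o2, 'm2) fctr"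
  assumes C: "is_category C" and D: "is_category D" and F: "is_functor C D F"
    and faithful: "\<And>X Y f g. \<lbrakk>X \<in> Ob C; Y \<in> Ob C; f \<in> Hom C X Y; g \<in> Hom C X Y;
      mor_map F X Y f = mor_map F X Y g\<rbrakk> \<Longrightarrow> f = g"
    and full: "\<And>X Y h. \<lbrakk>X \<in> Ob C; Y \<in> Ob C; h \<in> Hom D (obj_map F X) (obj_map F Y)\<rbrakk>
      \<Longrightarrow> \<exists>f\<in>Hom C X Y. mor_map F X Y f = h"
    and ess_surj: "\<And>Y. Y \<in> Ob D \<Longrightarrow> \<exists>X\<in>Ob C. \<exists>e. is_iso D Y (obj_map F X) e"
begin

lemma comp_C: "\<lbrakk>X \<in> Ob C; Y \<in> Ob C; Z \<in> Ob C; f \<in> Hom C X Y; g \<in> Hom C Y Z\<rbrakk>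
    \<Longrightarrow> Comp C X Y Z g f \<in> Hom C X Z"
  and id_C: "X \<in> Ob C \<Longrightarrow> Idm C X \<in> Hom C X X"
  using C unfolding is_category_def by blast+

lemma comp_D: "\<lbrakk>X \<in> Ob D; Y \<in> Ob D; Z \<in> Ob D; f \<in> Hom D X Y; g \<in> Hom D Y Z\<rbrakk>
    \<Longrightarrow> Comp D X Y Z g f \<in> Hom D X Z"
  and id_D: "X \<in> Ob D \<Longrightarrow> Idm D X \<in> Hom D X X"
  and id_right_D: "\<lbrakk>X \<in> Ob D; Y \<in> Ob D; f \<in> Hom D X Y\<rbrakk> \<Longrightarrow> Comp D X X Y f (Idm D X) = f"
  and id_left_D: "\<lbrakk>X \<in> Ob D; Y \<in> Ob D; f \<in> Hom D X Y\<rbrakk> \<Longrightarrow> Comp D X Y Y (Idm D Y) f = f"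
  and assoc_D: "\<lbrakk>W \<in> Ob D; X \<in> Ob D; Y \<in> Ob D; Z \<in> Ob D; f \<in> Hom D W X; g \<in> Hom D X Y;
      h \<in> Hom D Y Z\<rbrakk>
    \<Longrightarrow> Comp D W Y Z h (Comp D W X Y g f) = Comp D W X Z (Comp D X Y Z h g) f"
  using D unfolding is_category_def by blast+

lemma obj_F: "X \<in> Ob C \<Longrightarrow> obj_map F X \<in> Ob D"
  and mor_F: "\<lbrakk>X \<in> Ob C; Y \<in> Ob C; f \<in> Hom C X Y\<rbrakk>
    \<Longrightarrow> mor_map F X Y f \<in> Hom D (obj_map F X) (obj_map F Y)"
  and id_F: "X \<in> Ob C \<Longrightarrow> mor_map F X X (Idm C X) = Idm D (obj_map F X)"
  and comp_F: "\<lbrakk>X \<in> Ob C; Y \<in> Ob C; Z \<in> Ob C; f \<in> Hom C X Y; g \<in> Hom C Y Z\<rbrakk>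
    \<Longrightarrow> mor_map F X Z (Comp C X Y Z g f) =
      Comp D (obj_map F X) (obj_map F Y) (obj_map F Z) (mor_map F Y Z g) (mor_map F X Y f)"
  using F unfolding is_functor_def by blast+

definition pre :: "'o2 \<Rightarrow> 'o1" where
  "pre Y = (SOME X. X \<in> Ob C \<and> (\<exists>e. is_iso D Y (obj_map F X) e))"

abbreviation im :: "'o2 \<Rightarrow> 'o2" where
  "im Y \<equiv> obj_map F (pre Y)"

definition \<epsilon> :: "'o2 \<Rightarrow> 'm2" where
  "\<epsilon> Y = (SOME e. is_iso D Y (im Y) e)"

text \<open>\<open>is_iso\<close> asserts only that an inverse exists; fixing one makes the
  conjugation in \<open>push\<close> a function.\<close>

definition \<delta> :: "'o2 \<Rightarrow> 'm2" where
  "\<delta> Y = (SOME d. d \<in> Hom D (im Y) Y \<and> Comp D Y (im Y) Y d (\<epsilon> Y) = Idm D Y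
     \<and> Comp D (im Y) Y (im Y) (\<epsilon> Y) d = Idm D (im Y))"

lemma pre: "Y \<in> Ob D \<Longrightarrow> pre Y \<in> Ob C"
  and iso_\<epsilon>: "Y \<in> Ob D \<Longrightarrow> is_iso D Y (im Y) (\<epsilon> Y)"
proof -
  assume "Y \<in> Ob D"
  then have "\<exists>X. X \<in> Ob C \<and> (\<exists>e. is_iso D Y (obj_map F X) e)"
    using ess_surj by blast
  from someI_ex[OF this] have *: "pre Y \<in> Ob C \<and> (\<exists>e. is_iso D Y (im Y) e)"
    unfolding pre_def .
  then show "pre Y \<in> Ob C" by blast
  from * show "is_iso D Y (im Y) (\<epsilon> Y)" unfolding \<epsilon>_def by (blast intro: someI_ex)
qed

lemma im: "Y \<in> Ob D \<Longrightarrow> im Y \<in> Ob D"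
  by (simp add: obj_F pre)

lemma \<epsilon>: "Y \<in> Ob D \<Longrightarrow> \<epsilon> Y \<in> Hom D Y (im Y)"
  using iso_\<epsilon> unfolding is_iso_def by blast

lemma \<delta>: "Y \<in> Ob D \<Longrightarrow> \<delta> Y \<in> Hom D (im Y) Y"
  and \<delta>_\<epsilon>: "Y \<in> Ob D \<Longrightarrow> Comp D Y (im Y) Y (\<delta> Y) (\<epsilon> Y) = Idm D Y"
  and \<epsilon>_\<delta>: "Y \<in> Ob D \<Longrightarrow> Comp D (im Y) Y (im Y) (\<epsilon> Y) (\<delta> Y) = Idm D (im Y)"
proof -
  assume "Y \<in> Ob D"
  then have "\<exists>d. d \<in> Hom D (im Y) Y \<and> Comp D Y (im Y) Y d (\<epsilon> Y) = Idm D Y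
     \<and> Comp D (im Y) Y (im Y) (\<epsilon> Y) d = Idm D (im Y)"
    using iso_\<epsilon> unfolding is_iso_def by blast
  from someI_ex[OF this]
  show "\<delta> Y \<in> Hom D (im Y) Y" "Comp D Y (im Y) Y (\<delta> Y) (\<epsilon> Y) = Idm D Y"
    "Comp D (im Y) Y (im Y) (\<epsilon> Y) (\<delta> Y) = Idm D (im Y)"
    unfolding \<delta>_def by blast+
qed

definition lift :: "'o1 \<Rightarrow> 'o1 \<Rightarrow> 'm2 \<Rightarrow> 'm1" where
  "lift X Y h = (SOME f. f \<in> Hom C X Y \<and> mor_map F X Y f = h)"

lemma lift:
  assumes "X \<in> Ob C" "Y \<in> Ob C" "h \<in> Hom D (obj_map F X) (obj_map F Y)"
  shows "lift X Y h \<in> Hom C X Y" "mor_map F X Y (lift X Y h) = h"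
proof -
  have "\<exists>f. f \<in> Hom C X Y \<and> mor_map F X Y f = h"
    using full[OF assms] by blast
  from someI_ex[OF this] show "lift X Y h \<in> Hom C X Y" "mor_map F X Y (lift X Y h) = h"
    unfolding lift_def by blast+
qed

text \<open>Conjugation by \<open>\<epsilon>\<close>: the image under F that the quasi-inverse must
  give to \<open>g\<close> if \<open>\<epsilon>\<close> is to be natural.\<close>

definition push :: "'o2 \<Rightarrow> 'o2 \<Rightarrow> 'm2 \<Rightarrow> 'm2" where
  "push Y Z g = Comp D (im Y) Z (im Z) (\<epsilon> Z) (Comp D (im Y) Y Z g (\<delta> Y))"

lemma push: "\<lbrakk>Y \<in> Ob D; Z \<in> Ob D; g \<in> Hom D Y Z\<rbrakk> \<Longrightarrow> push Y Z g \<in> Hom D (im Y) (im Z)"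
  unfolding push_def by (meson \<delta> \<epsilon> comp_D im)

lemma push_\<epsilon>:
  assumes "Y \<in> Ob D" "Z \<in> Ob D" "g \<in> Hom D Y Z"
  shows "Comp D Y (im Y) (im Z) (push Y Z g) (\<epsilon> Y) = Comp D Y Z (im Z) (\<epsilon> Z) g"
proof -
  note [simp] = assms im \<delta> \<epsilon> comp_D
  have "Comp D Y (im Y) (im Z) (push Y Z g) (\<epsilon> Y)
      = Comp D Y Z (im Z) (\<epsilon> Z) (Comp D Y (im Y) Z (Comp D (im Y) Y Z g (\<delta> Y)) (\<epsilon> Y))"
    unfolding push_def by (rule assoc_D[symmetric]) simp_all
  also have "Comp D Y (im Y) Z (Comp D (im Y) Y Z g (\<delta> Y)) (\<epsilon> Y)
      = Comp D Y Y Z g (Comp D Y (im Y) Y (\<delta> Y) (\<epsilon> Y))"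
    by (rule assoc_D[symmetric]) simp_all
  finally show ?thesis by (simp add: \<delta>_\<epsilon> id_right_D)
qed

text \<open>\<open>\<epsilon> Y\<close> is invertible and can be cancelled on the right. Identities
  between pushed morphisms thus reduce to commuting squares.\<close>

lemma push_unique:
  assumes "Y \<in> Ob D" "Z \<in> Ob D" "k \<in> Hom D (im Y) (im Z)" "g \<in> Hom D Y Z"
    and "Comp D Y (im Y) (im Z) k (\<epsilon> Y) = Comp D Y Z (im Z) (\<epsilon> Z) g"
  shows "k = push Y Z g"
proof -
  note [simp] = assms(1-4) im \<delta> \<epsilon> comp_D
  have "k = Comp D (im Y) (im Y) (im Z) k (Comp D (im Y) Y (im Y) (\<epsilon> Y) (\<delta> Y))"
    by (simp add: \<epsilon>_\<delta> id_right_D)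
  also have "\<dots> = Comp D (im Y) Y (im Z) (Comp D Y (im Y) (im Z) k (\<epsilon> Y)) (\<delta> Y)"
    by (rule assoc_D) simp_all
  also have "\<dots> = push Y Z g"
    unfolding assms(5) push_def by (rule assoc_D[symmetric]) simp_all
  finally show ?thesis .
qed

definition G :: "('o2, 'm2, 'o1, 'm1) fctr" where
  "G = \<lparr>obj_map = pre, mor_map = (\<lambda>Y Z g. lift (pre Y) (pre Z) (push Y Z g))\<rparr>"

lemma mor_G:
  assumes "Y \<in> Ob D" "Z \<in> Ob D" "g \<in> Hom D Y Z"
  shows "mor_map G Y Z g \<in> Hom C (pre Y) (pre Z)"
    "mor_map F (pre Y) (pre Z) (mor_map G Y Z g) = push Y Z g"
  using assms by (simp_all add: G_def lift pre push)

text \<open>Both functor laws are checked after applying F, where \<open>push_unique\<close> decides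
  them; faithfulness then removes F.\<close>

lemma functor_G: "is_functor D C G"
  unfolding is_functor_def
proof (intro conjI ballI)
  show "obj_map G Y \<in> Ob C" if "Y \<in> Ob D" for Y
    using that by (simp add: G_def pre)
  show "mor_map G Y Z g \<in> Hom C (obj_map G Y) (obj_map G Z)"
    if "Y \<in> Ob D" "Z \<in> Ob D" "g \<in> Hom D Y Z" for Y Z g
    using mor_G(1)[OF that] by (simp add: G_def)
  show "mor_map G Y Y (Idm D Y) = Idm C (obj_map G Y)" if Y: "Y \<in> Ob D" for Y
  proof -
    have "Idm D (im Y) = push Y Y (Idm D Y)"
      by (rule push_unique) (simp_all add: Y im id_D \<epsilon> id_left_D id_right_D)
    then have "mor_map G Y Y (Idm D Y) = Idm C (pre Y)"
      using faithful[OF pre pre mor_G(1) id_C] Y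
      by (simp add: mor_G id_D id_F pre)
    then show ?thesis by (simp add: G_def)
  qed
  show "mor_map G W Z (Comp D W Y Z g f) =
      Comp C (obj_map G W) (obj_map G Y) (obj_map G Z) (mor_map G Y Z g) (mor_map G W Y f)"
    if W: "W \<in> Ob D" and Y: "Y \<in> Ob D" and Z: "Z \<in> Ob D" and f: "f \<in> Hom D W Y"
      and g: "g \<in> Hom D Y Z" for W Y Z f g
  proof -
    note [simp] = W Y Z f g im pre \<epsilon> push comp_D comp_C mor_G
    let ?k = "Comp D (im W) (im Y) (im Z) (push Y Z g) (push W Y f)"
    \<comment> \<open>The naturality squares of \<open>f\<close> and \<open>g\<close> are pasted, so
      \<open>?k\<close> solves the square that characterises the push of the composite.\<close>
    have "Comp D W (im W) (im Z) ?k (\<epsilon> W)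
        = Comp D W (im Y) (im Z) (push Y Z g) (Comp D W (im W) (im Y) (push W Y f) (\<epsilon> W))"
      by (rule assoc_D[symmetric]) simp_all
    also have "\<dots> = Comp D W (im Y) (im Z) (push Y Z g) (Comp D W Y (im Y) (\<epsilon> Y) f)"
      by (simp add: push_\<epsilon>)
    also have "\<dots> = Comp D W Y (im Z) (Comp D Y (im Y) (im Z) (push Y Z g) (\<epsilon> Y)) f"
      by (rule assoc_D) simp_all
    also have "\<dots> = Comp D W Y (im Z) (Comp D Y Z (im Z) (\<epsilon> Z) g) f"
      by (simp add: push_\<epsilon>)
    also have "\<dots> = Comp D W Z (im Z) (\<epsilon> Z) (Comp D W Y Z g f)"
      by (rule assoc_D[symmetric]) simp_all
    finally have "?k = push W Z (Comp D W Y Z g f)"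
      by (intro push_unique) (simp_all add: comp_D[OF im im im])
    then have "mor_map G W Z (Comp D W Y Z g f)
        = Comp C (pre W) (pre Y) (pre Z) (mor_map G Y Z g) (mor_map G W Y f)"
      by (intro faithful[of "pre W" "pre Z"]) (simp_all add: comp_F[where Y = "pre Y"]  comp_C[where Y = "pre Y"] comp_D[where Y = "Y"])
    then show ?thesis by (simp add: G_def)
  qed
qed

text \<open>The lift of the inverse is inverse to the lift: F sends both composites to identities,
  and F is faithful.\<close>

lemma iso_lift:
  assumes X: "X \<in> Ob C" and Y: "Y \<in> Ob C" and e: "is_iso D (obj_map F X) (obj_map F Y) e"
  shows "is_iso C X Y (lift X Y e)"
proof -
  let ?X = "obj_map F X" and ?Y = "obj_map F Y"
  obtain d where d: "d \<in> Hom D ?Y ?X" "Comp D ?X ?Y ?X d e = Idm D ?X"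
    "Comp D ?Y ?X ?Y e d = Idm D ?Y" and e: "e \<in> Hom D ?X ?Y"
    using e unfolding is_iso_def by blast
  note le = lift[OF X Y e] and ld = lift[OF Y X d(1)]
  have "Comp C X Y X (lift Y X d) (lift X Y e) = Idm C X"
    by (rule faithful[OF X X comp_C[OF X Y X le(1) ld(1)] id_C[OF X]])
      (simp add: comp_F[OF X Y X le(1) ld(1)] le ld d id_F X)
  moreover have "Comp C Y X Y (lift X Y e) (lift Y X d) = Idm C Y"
    by (rule faithful[OF Y Y comp_C[OF Y X Y ld(1) le(1)] id_C[OF Y]])
      (simp add: comp_F[OF Y X Y ld(1) le(1)] le ld d id_F Y)
  ultimately show ?thesis
    using le(1) ld(1) unfolding is_iso_def by blast
qed

text \<open>On the side of D the natural isomorphism is \<open>\<epsilon>\<close> itself. On the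
  side of C its component at \<open>F X\<close> is lifted along F, and naturality is again
  \<open>push_\<epsilon>\<close>, read through faithfulness.\<close>

lemma equivalent: "equivalent_categories C D"
proof -
  have "naturally_isomorphic D D id_fctr (comp_fctr F G)"
    unfolding naturally_isomorphic_def
  proof (intro exI[of _ \<epsilon>] conjI ballI)
    show "is_iso D (obj_map id_fctr Y) (obj_map (comp_fctr F G) Y) (\<epsilon> Y)" if "Y \<in> Ob D" for Y
      using iso_\<epsilon>[OF that] by (simp add: id_fctr_def comp_fctr_def G_def)
    show "Comp D (obj_map id_fctr Y) (obj_map id_fctr Z) (obj_map (comp_fctr F G) Z)
          (\<epsilon> Z) (mor_map id_fctr Y Z g) =
        Comp D (obj_map id_fctr Y) (obj_map (comp_fctr F G) Y) (obj_map (comp_fctr F G) Z)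
          (mor_map (comp_fctr F G) Y Z g) (\<epsilon> Y)"
      if "Y \<in> Ob D" "Z \<in> Ob D" "g \<in> Hom D Y Z" for Y Z g
      using push_\<epsilon>[OF that] mor_G(2)[OF that] by (simp add: id_fctr_def comp_fctr_def G_def)
  qed
  moreover have "naturally_isomorphic C C id_fctr (comp_fctr G F)"
    unfolding naturally_isomorphic_def
  proof (intro exI[of _ "\<lambda>X. lift X (pre (obj_map F X)) (\<epsilon> (obj_map F X))"] conjI ballI)
    show "is_iso C (obj_map id_fctr X) (obj_map (comp_fctr G F) X)
        (lift X (pre (obj_map F X)) (\<epsilon> (obj_map F X)))" if "X \<in> Ob C" for X
      using iso_lift[OF that pre iso_\<epsilon>] that by (simp add: id_fctr_def comp_fctr_def G_def obj_F)
    show "Comp C (obj_map id_fctr X) (obj_map id_fctr Y) (obj_map (comp_fctr G F) Y)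
          (lift Y (pre (obj_map F Y)) (\<epsilon> (obj_map F Y))) (mor_map id_fctr X Y f) =
        Comp C (obj_map id_fctr X) (obj_map (comp_fctr G F) X) (obj_map (comp_fctr G F) Y)
          (mor_map (comp_fctr G F) X Y f) (lift X (pre (obj_map F X)) (\<epsilon> (obj_map F X)))"
      if X: "X \<in> Ob C" and Y: "Y \<in> Ob C" and f: "f \<in> Hom C X Y" for X Y f
    proof -
      let ?X = "obj_map F X" and ?Y = "obj_map F Y" and ?f = "mor_map F X Y f"
      have X': "?X \<in> Ob D" and Y': "?Y \<in> Ob D" and f': "?f \<in> Hom D ?X ?Y"
        using X Y f by (simp_all add: obj_F mor_F)
      note lX = lift[OF X pre[OF X'] \<epsilon>[OF X']] and lY = lift[OF Y pre[OF Y'] \<epsilon>[OF Y']]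
        and g = mor_G[OF X' Y' f']
      have "Comp C X Y (pre ?Y) (lift Y (pre ?Y) (\<epsilon> ?Y)) f =
          Comp C X (pre ?X) (pre ?Y) (mor_map G ?X ?Y ?f) (lift X (pre ?X) (\<epsilon> ?X))"
      proof (rule faithful[OF X pre[OF Y']])
        show "Comp C X Y (pre ?Y) (lift Y (pre ?Y) (\<epsilon> ?Y)) f \<in> Hom C X (pre ?Y)"
          by (rule comp_C[OF X Y pre[OF Y'] f lY(1)])
        show "Comp C X (pre ?X) (pre ?Y) (mor_map G ?X ?Y ?f) (lift X (pre ?X) (\<epsilon> ?X))
            \<in> Hom C X (pre ?Y)"
          by (rule comp_C[OF X pre[OF X'] pre[OF Y'] lX(1) g(1)])
        show "mor_map F X (pre ?Y) (Comp C X Y (pre ?Y) (lift Y (pre ?Y) (\<epsilon> ?Y)) f) =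
            mor_map F X (pre ?Y)
              (Comp C X (pre ?X) (pre ?Y) (mor_map G ?X ?Y ?f) (lift X (pre ?X) (\<epsilon> ?X)))"
          by (simp add: comp_F[OF X Y pre[OF Y'] f lY(1)]
              comp_F[OF X pre[OF X'] pre[OF Y'] lX(1) g(1)] lX(2) lY(2) g(2)
              push_\<epsilon>[OF X' Y' f'])
      qed
      then show ?thesis by (simp add: id_fctr_def comp_fctr_def G_def)
    qed
  qed
  ultimately show ?thesis
    unfolding equivalent_categories_def using C D F functor_G by blast
qed

end

section \<open>Prime filters, clans and clusters\<close>

locale carrier_boolalg =
  fixes B :: "('a, 'm) boolalg_scheme"
  assumes boolean_alg: "boolean_alg B"
begin

abbreviation jn (infixl "\<squnion>" 65) where "x \<squnion> y \<equiv> join B x y"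
abbreviation mt (infixl "\<sqinter>" 70) where "x \<sqinter> y \<equiv> meet B x y"
abbreviation le (infix "\<sqsubseteq>" 50) where "x \<sqsubseteq> y \<equiv> leq B x y"

lemma closed [simp]:
  "bzero B \<in> elems B" "bone B \<in> elems B"
  "x \<in> elems B \<Longrightarrow> cmpl B x \<in> elems B"
  "\<lbrakk>x \<in> elems B; y \<in> elems B\<rbrakk> \<Longrightarrow> x \<squnion> y \<in> elems B"
  "\<lbrakk>x \<in> elems B; y \<in> elems B\<rbrakk> \<Longrightarrow> x \<sqinter> y \<in> elems B"
  using boolean_alg unfolding boolean_alg_def by blast+

lemma zero_neq_one: "bzero B \<noteq> bone B"
  using boolean_alg unfolding boolean_alg_def by blast

lemma basic [simp]:
  assumes "x \<in> elems B"
  shows "x \<sqinter> bone B = x" "x \<squnion> bzero B = x" "x \<sqinter> cmpl B x = bzero B" "x \<squnion> cmpl B x = bone B"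
  using boolean_alg assms unfolding boolean_alg_def by blast+

lemma join_comm: "\<lbrakk>x \<in> elems B; y \<in> elems B\<rbrakk> \<Longrightarrow> x \<squnion> y = y \<squnion> x"
  and meet_comm: "\<lbrakk>x \<in> elems B; y \<in> elems B\<rbrakk> \<Longrightarrow> x \<sqinter> y = y \<sqinter> x"
  using boolean_alg unfolding boolean_alg_def by blast+

lemma join_assoc: "\<lbrakk>x \<in> elems B; y \<in> elems B; z \<in> elems B\<rbrakk> \<Longrightarrow> (x \<squnion> y) \<squnion> z = x \<squnion> (y \<squnion> z)"
  and meet_assoc: "\<lbrakk>x \<in> elems B; y \<in> elems B; z \<in> elems B\<rbrakk> \<Longrightarrow> (x \<sqinter> y) \<sqinter> z = x \<sqinter> (y \<sqinter> z)"
  and meet_join_distrib: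
    "\<lbrakk>x \<in> elems B; y \<in> elems B; z \<in> elems B\<rbrakk> \<Longrightarrow> x \<sqinter> (y \<squnion> z) = (x \<sqinter> y) \<squnion> (x \<sqinter> z)"
  and join_meet_distrib:
    "\<lbrakk>x \<in> elems B; y \<in> elems B; z \<in> elems B\<rbrakk> \<Longrightarrow> x \<squnion> (y \<sqinter> z) = (x \<squnion> y) \<sqinter> (x \<squnion> z)"
  using boolean_alg unfolding boolean_alg_def by blast+

lemma join_idem [simp]:
  assumes "x \<in> elems B"
  shows "x \<squnion> x = x"
proof -
  have "x \<squnion> x = (x \<squnion> x) \<sqinter> (x \<squnion> cmpl B x)"
    using assms by simp
  also have "\<dots> = x \<squnion> (x \<sqinter> cmpl B x)"
    using assms by (intro join_meet_distrib[symmetric]) simp_all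
  finally show ?thesis using assms by simp
qed

lemma join_one [simp]:
  assumes "x \<in> elems B"
  shows "x \<squnion> bone B = bone B"
proof -
  have "x \<squnion> bone B = (x \<squnion> x) \<squnion> cmpl B x"
    using join_assoc[of x x "cmpl B x"] assms by simp
  then show ?thesis using assms by simp
qed

lemma absorb [simp]:
  assumes "x \<in> elems B" "y \<in> elems B"
  shows "x \<squnion> (x \<sqinter> y) = x" "x \<sqinter> (x \<squnion> y) = x"
proof -
  show 1: "x \<squnion> (x \<sqinter> y) = x"
    using meet_join_distrib[of x "bone B" y] join_comm[of "bone B" y] assms by simp
  show "x \<sqinter> (x \<squnion> y) = x"
    using join_meet_distrib[of x x y] 1 assms by simp
qed

lemma leq_meet: "\<lbrakk>x \<in> elems B; y \<in> elems B\<rbrakk> \<Longrightarrow> x \<sqsubseteq> y \<longleftrightarrow> x \<sqinter> y = x"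
  unfolding leq_def by (metis absorb join_comm meet_comm)

lemma leq_refl [simp]: "x \<in> elems B \<Longrightarrow> x \<sqsubseteq> x"
  by (simp add: leq_def)

lemma leq_trans: "\<lbrakk>x \<sqsubseteq> y; y \<sqsubseteq> z; x \<in> elems B; y \<in> elems B; z \<in> elems B\<rbrakk> \<Longrightarrow> x \<sqsubseteq> z"
  unfolding leq_def by (metis join_assoc)

lemma leq_antisym: "\<lbrakk>x \<sqsubseteq> y; y \<sqsubseteq> x; x \<in> elems B; y \<in> elems B\<rbrakk> \<Longrightarrow> x = y"
  unfolding leq_def by (metis join_comm)

lemma zero_leq [simp]: "x \<in> elems B \<Longrightarrow> bzero B \<sqsubseteq> x"
  by (metis basic(2) closed(1) join_comm leq_def)

lemma leq_one [simp]: "x \<in> elems B \<Longrightarrow> x \<sqsubseteq> bone B"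
  by (simp add: leq_def)

lemma leq_join [simp]:
  assumes "x \<in> elems B" "y \<in> elems B"
  shows "x \<sqsubseteq> x \<squnion> y" "y \<sqsubseteq> x \<squnion> y"
  using assms by (simp_all add: leq_meet) (metis absorb(2) join_comm)

lemma meet_leq [simp]:
  assumes "x \<in> elems B" "y \<in> elems B"
  shows "x \<sqinter> y \<sqsubseteq> x" "x \<sqinter> y \<sqsubseteq> y"
  using assms by (metis absorb(1) closed(5) join_comm leq_def meet_comm)+

lemma leq_meetI:
  "\<lbrakk>z \<sqsubseteq> x; z \<sqsubseteq> y; x \<in> elems B; y \<in> elems B; z \<in> elems B\<rbrakk> \<Longrightarrow> z \<sqsubseteq> x \<sqinter> y"
  unfolding leq_def by (metis join_meet_distrib)

lemma meet_mono:
  assumes "x \<sqsubseteq> x'" "y \<sqsubseteq> y'" "x \<in> elems B" "y \<in> elems B" "x' \<in> elems B" "y' \<in> elems B"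
  shows "x \<sqinter> y \<sqsubseteq> x' \<sqinter> y'"
proof (rule leq_meetI)
  show "x \<sqinter> y \<sqsubseteq> x'"
    by (rule leq_trans[OF meet_leq(1) assms(1)]) (simp_all add: assms)
  show "x \<sqinter> y \<sqsubseteq> y'"
    by (rule leq_trans[OF meet_leq(2) assms(2)]) (simp_all add: assms)
qed (use assms in simp_all)

lemma join_leqI:
  "\<lbrakk>x \<sqsubseteq> z; y \<sqsubseteq> z; x \<in> elems B; y \<in> elems B; z \<in> elems B\<rbrakk> \<Longrightarrow> x \<squnion> y \<sqsubseteq> z"
  unfolding leq_def by (metis join_assoc)

text \<open>Turns an inequality below a complement into a covering condition; the closure
  computation in the clan space needs it in this form.\<close>

lemma cmpl_leq_iff:
  assumes "x \<in> elems B" "y \<in> elems B"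
  shows "cmpl B x \<sqsubseteq> y \<longleftrightarrow> x \<squnion> y = bone B"
proof
  assume "cmpl B x \<sqsubseteq> y"
  then show "x \<squnion> y = bone B"
    using join_assoc[of x "cmpl B x" y] join_comm[of "bone B" y] assms by (simp add: leq_def)
next
  assume "x \<squnion> y = bone B"
  then have "cmpl B x = cmpl B x \<sqinter> (x \<squnion> y)"
    using assms by simp
  also have "\<dots> = cmpl B x \<sqinter> y"
    using meet_join_distrib[of "cmpl B x" x y] meet_comm[of "cmpl B x" x]
      join_comm[of "bzero B" "cmpl B x \<sqinter> y"] assms by simp
  finally show "cmpl B x \<sqsubseteq> y"
    using assms by (simp add: leq_meet)
qed

lemma cmpl_cmpl [simp]: "x \<in> elems B \<Longrightarrow> cmpl B (cmpl B x) = x"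
proof (rule leq_antisym)
  assume x: "x \<in> elems B"
  then show "cmpl B (cmpl B x) \<sqsubseteq> x"
    by (simp add: cmpl_leq_iff join_comm)
  have "x \<sqinter> cmpl B (cmpl B x) = x \<sqinter> (cmpl B x \<squnion> cmpl B (cmpl B x))"
    using x meet_join_distrib[of x "cmpl B x" "cmpl B (cmpl B x)"]
      join_comm[of "bzero B" "x \<sqinter> cmpl B (cmpl B x)"] by simp
  also have "\<dots> = x"
    using x by simp
  finally show "x \<sqsubseteq> cmpl B (cmpl B x)"
    using x by (simp add: leq_meet)
qed simp_all

lemma cmpl_antimono: "\<lbrakk>x \<sqsubseteq> y; x \<in> elems B; y \<in> elems B\<rbrakk> \<Longrightarrow> cmpl B y \<sqsubseteq> cmpl B x"
proof -
  assume "x \<sqsubseteq> y" and el: "x \<in> elems B" "y \<in> elems B"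
  then have "y \<squnion> cmpl B x = (x \<squnion> cmpl B x) \<squnion> y"
    using join_assoc[of x "cmpl B x" y] join_assoc[of x y "cmpl B x"]
      join_comm[of y "cmpl B x"] by (simp add: leq_def)
  then show "cmpl B y \<sqsubseteq> cmpl B x"
    using el join_comm[of "bone B" y] by (simp add: cmpl_leq_iff)
qed

text \<open>De Morgan's law. It reaches the meet through join and complement, the operations under
  which the sets \<open>h a\<close> are easy to compute.\<close>

lemma cmpl_join_cmpl:
  assumes "x \<in> elems B" "y \<in> elems B"
  shows "cmpl B (cmpl B x \<squnion> cmpl B y) = x \<sqinter> y"
proof (rule leq_antisym)
  have "cmpl B (cmpl B x \<squnion> cmpl B y) \<sqsubseteq> x" "cmpl B (cmpl B x \<squnion> cmpl B y) \<sqsubseteq> y"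
    using assms cmpl_antimono[of "cmpl B x" "cmpl B x \<squnion> cmpl B y"]
      cmpl_antimono[of "cmpl B y" "cmpl B x \<squnion> cmpl B y"] by simp_all
  then show "cmpl B (cmpl B x \<squnion> cmpl B y) \<sqsubseteq> x \<sqinter> y"
    using assms by (simp add: leq_meetI)
  have "cmpl B x \<squnion> cmpl B y \<sqsubseteq> cmpl B (x \<sqinter> y)"
    using assms by (simp add: cmpl_antimono join_leqI)
  then show "x \<sqinter> y \<sqsubseteq> cmpl B (cmpl B x \<squnion> cmpl B y)"
    using assms cmpl_antimono[of "cmpl B x \<squnion> cmpl B y" "cmpl B (x \<sqinter> y)"] by simp
qed (use assms in simp_all)

section \<open>Grills and prime filters\<close>

text \<open>A grill is the complement of an ideal. Clans are grills with a unit and a relatedness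
  condition, so results on grills serve every relation.\<close>

definition grill :: "'a set \<Rightarrow> bool" where
  "grill G \<longleftrightarrow> G \<subseteq> elems B \<and> bzero B \<notin> G \<and> (\<forall>a\<in>G. \<forall>b\<in>elems B. a \<sqsubseteq> b \<longrightarrow> b \<in> G) \<and>
    (\<forall>a\<in>elems B. \<forall>b\<in>elems B. a \<squnion> b \<in> G \<longrightarrow> a \<in> G \<or> b \<in> G)"

definition prime_filter :: "'a set \<Rightarrow> bool" where
  "prime_filter U \<longleftrightarrow> grill U \<and> bone B \<in> U \<and> (\<forall>a\<in>U. \<forall>b\<in>U. a \<sqinter> b \<in> U)"

lemma grillI:
  assumes "G \<subseteq> elems B" "bzero B \<notin> G" "\<And>a b. \<lbrakk>a \<in> G; b \<in> elems B; a \<sqsubseteq> b\<rbrakk> \<Longrightarrow> b \<in> G"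
    "\<And>a b. \<lbrakk>a \<in> elems B; b \<in> elems B; a \<squnion> b \<in> G\<rbrakk> \<Longrightarrow> a \<in> G \<or> b \<in> G"
  shows "grill G"
  using assms unfolding grill_def by blast

lemma clan_iff: "clan B R \<Gamma> \<longleftrightarrow> grill \<Gamma> \<and> bone B \<in> \<Gamma> \<and> (\<forall>a\<in>\<Gamma>. \<forall>b\<in>\<Gamma>. R a b)"
  unfolding clan_def grill_def by blast

text \<open>The prime ideal theorem in grill form: by Zorn's lemma there is a maximal filter among
  those that contain \<open>a\<close> and avoid the ideal \<open>elems B - G\<close>, and such a
  filter is prime.\<close>

lemma prime_filter_in_grill:
  assumes G: "grill G" and a: "a \<in> G"
  shows "\<exists>U. prime_filter U \<and> a \<in> U \<and> U \<subseteq> G"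
proof -
  have Gel: "x \<in> elems B" if "x \<in> G" for x
    using G that unfolding grill_def by blast
  have Gup: "y \<in> G" if "x \<in> G" "y \<in> elems B" "x \<sqsubseteq> y" for x y
    using G that unfolding grill_def by blast
  define \<F> where "\<F> = {U. U \<subseteq> G \<and> a \<in> U \<and> (\<forall>x\<in>U. \<forall>y\<in>elems B. x \<sqsubseteq> y \<longrightarrow> y \<in> U)
    \<and> (\<forall>x\<in>U. \<forall>y\<in>U. x \<sqinter> y \<in> U)}"
  have "y \<in> {x \<in> elems B. a \<sqsubseteq> x}" if "x \<in> {x \<in> elems B. a \<sqsubseteq> x}" "y \<in> elems B" "x \<sqsubseteq> y" for x y
    using that leq_trans[of a x y] Gel[OF a] by simp
  \<comment> \<open>The principal filter of \<open>a\<close> makes the family nonempty.\<close>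
  then have "{x \<in> elems B. a \<sqsubseteq> x} \<in> \<F>"
    unfolding \<F>_def using Gup[OF a] Gel[OF a] by (simp add: leq_meetI subset_iff)
  then have "\<F> \<noteq> {}" by blast
  moreover have "\<Union>\<C> \<in> \<F>" if "\<C> \<noteq> {}" and chain: "subset.chain \<F> \<C>" for \<C>
  proof -
    have in\<F>: "U \<in> \<F>" if "U \<in> \<C>" for U
      using chain that unfolding subset.chain_def by blast
    have "x \<sqinter> y \<in> \<Union>\<C>" if "x \<in> U" "y \<in> V" "U \<in> \<C>" "V \<in> \<C>" for x y U V
    proof -
      have "U \<subseteq> V \<or> V \<subseteq> U"
        using chain that unfolding subset_chain_def by blast
      then show ?thesis
        using that in\<F> unfolding \<F>_def by blast
    qed
    then have 1: "\<forall>x\<in>\<Union>\<C>. \<forall>y\<in>\<Union>\<C>. x \<sqinter> y \<in> \<Union>\<C>" by (meson UnionE)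
    have 2: "\<Union>\<C> \<subseteq> G" "a \<in> \<Union>\<C>"
      using in\<F> \<open>\<C> \<noteq> {}\<close> unfolding \<F>_def by blast+
    have 3: "\<forall>x\<in>\<Union>\<C>. \<forall>y\<in>elems B. x \<sqsubseteq> y \<longrightarrow> y \<in> \<Union>\<C>"
      using in\<F> unfolding \<F>_def by blast
    show ?thesis
      unfolding \<F>_def mem_Collect_eq by (intro conjI 1 2 3)
  qed
  ultimately obtain U where U: "U \<in> \<F>" and max: "\<And>V. V \<in> \<F> \<Longrightarrow> U \<subseteq> V \<Longrightarrow> V = U"
    using subset_Zorn_nonempty[of \<F>] by metis
  have UG: "U \<subseteq> G" and aU: "a \<in> U"
    and Uup: "\<And>x y. \<lbrakk>x \<in> U; y \<in> elems B; x \<sqsubseteq> y\<rbrakk> \<Longrightarrow> y \<in> U"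
    and Umt: "\<And>x y. \<lbrakk>x \<in> U; y \<in> U\<rbrakk> \<Longrightarrow> x \<sqinter> y \<in> U"
    using U unfolding \<F>_def by blast+
  have Uel: "x \<in> elems B" if "x \<in> U" for x
    using UG Gel that by blast
  \<comment> \<open>By maximality the filter \<open>V\<close> generated by \<open>U\<close> and
    \<open>x\<close> must leave \<open>G\<close>; since \<open>G\<close> is upward closed, some
    generator \<open>u \<sqinter> x\<close> already does.\<close>
  have ext: "\<exists>u\<in>U. u \<sqinter> x \<notin> G" if x: "x \<in> elems B" "x \<notin> U" for x
  proof (rule ccontr)
    assume neg: "\<not> ?thesis"
    define V where "V = {z \<in> elems B. \<exists>u\<in>U. u \<sqinter> x \<sqsubseteq> z}"
    have "z \<in> G" if "z \<in> V" for z
      using that neg Gup unfolding V_def by blast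
    moreover have "u \<in> V" if "u \<in> U" for u
      using that Uel x unfolding V_def by (auto intro!: bexI[of _ u])
    moreover have "z' \<in> V" if "z \<in> V" "z' \<in> elems B" "z \<sqsubseteq> z'" for z z'
    proof -
      obtain u where u: "u \<in> U" "u \<sqinter> x \<sqsubseteq> z" and z: "z \<in> elems B"
        using \<open>z \<in> V\<close> unfolding V_def by blast
      then have "u \<sqinter> x \<sqsubseteq> z'"
        using leq_trans[OF u(2) that(3)] Uel x that(2) by simp
      then show ?thesis
        unfolding V_def using u(1) that(2) by blast
    qed
    moreover have "z \<sqinter> z' \<in> V" if z: "z \<in> V" "z' \<in> V" for z z'
    proof -
      obtain u u' where u: "u \<in> U" "u' \<in> U" "u \<sqinter> x \<sqsubseteq> z" "u' \<sqinter> x \<sqsubseteq> z'"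
        using z unfolding V_def by blast
      have el: "u \<in> elems B" "u' \<in> elems B" "z \<in> elems B" "z' \<in> elems B"
        using u Uel z unfolding V_def by blast+
      have "(u \<sqinter> u') \<sqinter> x \<sqsubseteq> u \<sqinter> x" "(u \<sqinter> u') \<sqinter> x \<sqsubseteq> u' \<sqinter> x"
        using el x by (simp_all add: meet_mono)
      then have "(u \<sqinter> u') \<sqinter> x \<sqsubseteq> z \<sqinter> z'"
        using u el x leq_trans[of "(u \<sqinter> u') \<sqinter> x" "u \<sqinter> x" z]
          leq_trans[of "(u \<sqinter> u') \<sqinter> x" "u' \<sqinter> x" z'] by (simp add: leq_meetI)
      then show ?thesis
        unfolding V_def using Umt[OF u(1,2)] closed(5)[OF el(3,4)] by blast
    qed
    ultimately have "V \<in> \<F>"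
      unfolding \<F>_def using aU by blast
    moreover have "U \<subseteq> V"
      using \<open>\<And>u. u \<in> U \<Longrightarrow> u \<in> V\<close> by blast
    ultimately have "V = U" by (rule max)
    moreover have "x \<in> V"
      unfolding V_def using x aU Uel by (auto intro!: bexI[of _ a])
    ultimately show False using x by blast
  qed
  have "x \<in> U \<or> y \<in> U" if xy: "x \<in> elems B" "y \<in> elems B" "x \<squnion> y \<in> U" for x y
  proof (rule ccontr)
    assume "\<not> ?thesis"
    then obtain u v where uv: "u \<in> U" "v \<in> U" "u \<sqinter> x \<notin> G" "v \<sqinter> y \<notin> G"
      using ext xy by meson
    have el: "u \<in> elems B" "v \<in> elems B" using uv Uel by blast+
    \<comment> \<open>One element of \<open>U\<close> that serves \<open>x\<close> and
      \<open>y\<close> at once: its meets with them lie outside \<open>G\<close>, hence so does the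
      join of these meets, which by distributivity is a member of \<open>U\<close>.\<close>
    let ?w = "u \<sqinter> v"
    have "?w \<sqinter> x \<sqsubseteq> u \<sqinter> x" "?w \<sqinter> y \<sqsubseteq> v \<sqinter> y"
      using el xy by (simp_all add: meet_mono)
    then have "?w \<sqinter> x \<notin> G" "?w \<sqinter> y \<notin> G"
      using Gup[of "?w \<sqinter> x" "u \<sqinter> x"] Gup[of "?w \<sqinter> y" "v \<sqinter> y"] uv(3,4) el xy by auto
    then have "?w \<sqinter> x \<squnion> ?w \<sqinter> y \<notin> G"
      using G closed(5)[OF closed(5)[OF el] xy(1)] closed(5)[OF closed(5)[OF el] xy(2)]
      unfolding grill_def by blast
    moreover have "?w \<sqinter> (x \<squnion> y) \<in> G"
      using UG Umt uv xy by blast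
    ultimately show False
      using el xy by (simp add: meet_join_distrib)
  qed
  then have "grill U"
    unfolding grill_def using UG Uup Uel G unfolding grill_def by blast
  moreover have "bone B \<in> U"
    using Uup[OF aU] Uel[OF aU] by simp
  ultimately show ?thesis
    unfolding prime_filter_def using aU UG Umt by blast
qed

text \<open>The elements not below \<open>b\<close> are the complement of a principal ideal, hence a
  grill, and \<open>a\<close> belongs to it.\<close>

lemma prime_filter_separates:
  assumes "a \<in> elems B" "b \<in> elems B" "\<not> a \<sqsubseteq> b"
  shows "\<exists>U. prime_filter U \<and> a \<in> U \<and> b \<notin> U"
proof -
  have "grill {x \<in> elems B. \<not> x \<sqsubseteq> b}"
    unfolding grill_def using assms by (auto intro: join_leqI leq_trans)
  from prime_filter_in_grill[OF this, of a] show ?thesis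
    using assms by auto
qed

lemma prime_filter_cmpl:
  assumes "prime_filter U" "c \<in> elems B"
  shows "c \<in> U \<or> cmpl B c \<in> U"
  using assms unfolding prime_filter_def grill_def by (metis basic(4) closed(3))

text \<open>Two members have a nonzero meet, which forces contact. In a DCA a prime filter is
  therefore an s-clan and a t-clan at the same time.\<close>

lemma prime_filter_clan:
  assumes U: "prime_filter U" and R: "contact B R"
  shows "clan B R U"
proof -
  have "R a b" if "a \<in> U" "b \<in> U" for a b
  proof -
    have "a \<sqinter> b \<in> U" "a \<in> elems B" "b \<in> elems B" "bzero B \<notin> U"
      using that U unfolding prime_filter_def grill_def by blast+
    then show ?thesis
      using R unfolding contact_def by metis
  qed
  then show ?thesis
    using U unfolding clan_iff prime_filter_def by blast
qed

text \<open>Primality needs the filter property: if \<open>u\<close> refutes \<open>x\<close> and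
  \<open>v\<close> refutes \<open>y\<close>, then \<open>u \<sqinter> v\<close> is in
  \<open>U\<close> and refutes both, against additivity.\<close>

lemma grill_related_to_filter:
  assumes U: "prime_filter U" and R: "precontact B R"
  shows "grill {x \<in> elems B. \<forall>u\<in>U. R x u}"
proof -
  have Uel: "x \<in> elems B" if "x \<in> U" for x
    using U that unfolding prime_filter_def grill_def by blast
  have up: "R a' b'" if "R a b" "a \<sqsubseteq> a'" "b \<sqsubseteq> b'" "a' \<in> elems B" "b' \<in> elems B" for a b a' b'
    using R that unfolding precontact_def by blast
  have "(\<forall>u\<in>U. R x u) \<or> (\<forall>u\<in>U. R y u)"
    if xy: "x \<in> elems B" "y \<in> elems B" "\<And>u. u \<in> U \<Longrightarrow> R (x \<squnion> y) u" for x y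
  proof (rule ccontr)
    assume "\<not> ?thesis"
    then obtain u v where uv: "u \<in> U" "v \<in> U" "\<not> R x u" "\<not> R y v" by blast
    then have w: "u \<sqinter> v \<in> U" and el: "u \<in> elems B" "v \<in> elems B"
      using U Uel unfolding prime_filter_def by blast+
    have "R x (u \<sqinter> v) \<or> R y (u \<sqinter> v)"
      using R xy(1,2) xy(3)[OF w] el unfolding precontact_def by (meson closed(5))
    then show False
      using up uv xy el by (meson leq_refl meet_leq)
  qed
  note prime = this
  have zero: "\<not> R (bzero B) u" for u
    using R unfolding precontact_def by blast
  have one: "bone B \<in> U"
    using U unfolding prime_filter_def by blast
  show ?thesis
  proof (rule grillI)
    show "bzero B \<notin> {x \<in> elems B. \<forall>u\<in>U. R x u}"
      using zero one by blast
    show "y \<in> {x \<in> elems B. \<forall>u\<in>U. R x u}"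
      if "x \<in> {x \<in> elems B. \<forall>u\<in>U. R x u}" "y \<in> elems B" "x \<sqsubseteq> y" for x y
      using that up[OF _ \<open>x \<sqsubseteq> y\<close> leq_refl] Uel by simp
    show "x \<in> {x \<in> elems B. \<forall>u\<in>U. R x u} \<or> y \<in> {x \<in> elems B. \<forall>u\<in>U. R x u}"
      if "x \<in> elems B" "y \<in> elems B" "x \<squnion> y \<in> {x \<in> elems B. \<forall>u\<in>U. R x u}" for x y
      using that prime[of x y] by simp
  qed blast
qed

text \<open>The clan is the union of two prime filters, one containing each of the two elements.\<close>

lemma clan_exists:
  assumes R: "contact B R" and ab: "R a b"
  shows "\<exists>\<Gamma>. clan B R \<Gamma> \<and> a \<in> \<Gamma> \<and> b \<in> \<Gamma>"
proof -
  have P: "precontact B R" and sym: "\<And>x y. R x y \<Longrightarrow> R y x"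
    using R unfolding contact_def precontact_def by blast+
  have el: "x \<in> elems B" "y \<in> elems B" if "R x y" for x y
    using P that unfolding precontact_def by blast+
  have up: "R a' b'" if "R a b" "a \<sqsubseteq> a'" "b \<sqsubseteq> b'" "a' \<in> elems B" "b' \<in> elems B" for a b a' b'
    using P that unfolding precontact_def by blast
  have "R a x \<or> R a y" if "x \<in> elems B" "y \<in> elems B" "R a (x \<squnion> y)" for x y
    using P that el[OF ab] unfolding precontact_def by blast
  moreover have "\<not> R a (bzero B)"
    using P unfolding precontact_def by blast
  ultimately have "grill {x \<in> elems B. R a x}"
    unfolding grill_def using up[OF _ leq_refl] el[OF ab] by blast
  from prime_filter_in_grill[OF this, of b] obtain U where U: "prime_filter U" "b \<in> U"
    and aU: "\<And>u. u \<in> U \<Longrightarrow> R a u"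
    using ab el[OF ab] by blast
  \<comment> \<open>\<open>U\<close> was chosen inside the elements related to \<open>a\<close>, so
    \<open>a\<close> lies in the grill of elements related to all of \<open>U\<close>. A prime
    filter through \<open>a\<close> inside this grill is related to \<open>U\<close> member by
    member.\<close>
  from prime_filter_in_grill[OF grill_related_to_filter[OF U(1) P], of a] obtain V
    where V: "prime_filter V" "a \<in> V" and VU: "\<And>u v. u \<in> U \<Longrightarrow> v \<in> V \<Longrightarrow> R v u"
    using aU el[OF ab] by blast
  have "R x y" if "x \<in> U \<union> V" "y \<in> U \<union> V" for x y
    using that VU sym prime_filter_clan[OF U(1) R] prime_filter_clan[OF V(1) R]
    unfolding clan_def by blast
  then have "clan B R (U \<union> V)"
    using U(1) V(1) unfolding clan_iff prime_filter_def grill_def by blast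
  then show ?thesis using U V by blast
qed

end

section \<open>Clusters\<close>

text \<open>The cluster consists of everything in contact with all of \<open>U\<close>. An element
  left out fails to touch some member of \<open>U\<close>, and \<open>U\<close> lies inside the
  cluster, which gives maximality.\<close>

lemma cluster_of_prime_filter:
  assumes B: "is_dca B" and U: "carrier_boolalg.prime_filter B U"
  defines "\<Gamma> \<equiv> {x \<in> elems B. \<forall>u\<in>U. Ct B x u}"
  shows "cluster B \<Gamma>" "U \<subseteq> \<Gamma>"
proof -
  interpret carrier_boolalg B
    using B by (unfold_locales) (simp add: is_dca_def)
  have C: "contact B (Ct B)" and P: "precontact B (Ct B)"
    using B unfolding is_dca_def contact_def by blast+
  have sym: "Ct B x y \<Longrightarrow> Ct B y x" for x y
    using C unfolding contact_def precontact_def by blast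
  have Uel: "U \<subseteq> elems B"
    using U unfolding prime_filter_def grill_def by blast
  show U\<Gamma>: "U \<subseteq> \<Gamma>"
    using prime_filter_clan[OF U C] unfolding clan_def \<Gamma>_def by blast
  have "Ct B x y" if x: "x \<in> \<Gamma>" and y: "y \<in> \<Gamma>" for x y
  proof (rule ccontr)
    \<comment> \<open>The interpolation axiom for \<open>Ct\<close> splits the algebra by
      \<open>c\<close>. The prime filter contains \<open>c\<close> or its complement, and either one
      must touch both \<open>x\<close> and \<open>y\<close>.\<close>
    assume "\<not> Ct B x y"
    then obtain c where c: "c \<in> elems B" "\<not> Ct B x c" "\<not> Ct B (cmpl B c) y"
      using B x y unfolding is_dca_def \<Gamma>_def by blast
    then show False
      using prime_filter_cmpl[OF U c(1)] x y sym unfolding \<Gamma>_def by blast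
  qed
  then have "clan B (Ct B) \<Gamma>"
    unfolding clan_iff using grill_related_to_filter[OF U P] U\<Gamma> U
    unfolding prime_filter_def \<Gamma>_def by blast
  moreover have "\<exists>b\<in>\<Gamma>. \<not> Ct B a b" if "a \<in> elems B" "a \<notin> \<Gamma>" for a
    using that U\<Gamma> unfolding \<Gamma>_def by blast
  ultimately show "cluster B \<Gamma>"
    unfolding cluster_def t_clan_def by blast
qed

text \<open>\<open>Ct\<close> relates exactly the pairs of nonzero elements. A nonzero element
  outside a cluster would be in contact with all its members, contrary to the cluster
  condition.\<close>

lemma trivial_cluster_iff:
  assumes B: "trivial_dca B"
  shows "cluster B \<Gamma> \<longleftrightarrow> \<Gamma> = elems B - {bzero B}"
proof -
  interpret carrier_boolalg B
    using B by (unfold_locales) (simp add: is_dca_def trivial_dca_def)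
  have C: "contact B (Ct B)"
    using B unfolding trivial_dca_def is_dca_def by blast
  have Ct: "Ct B a b \<longleftrightarrow> a \<in> elems B - {bzero B} \<and> b \<in> elems B - {bzero B}" for a b
    using B C unfolding trivial_dca_def contact_def precontact_def by blast
  have "grill (elems B - {bzero B})"
    by (rule grillI) (auto intro: leq_antisym)
  then have "clan B (Ct B) (elems B - {bzero B})"
    using zero_neq_one by (auto simp: clan_iff Ct)
  then have "cluster B (elems B - {bzero B})"
    unfolding cluster_def t_clan_def using zero_neq_one by (auto simp: Ct intro: bexI[of _ "bone B"] exI[of _ "bone B"])
  moreover have "\<Gamma> = elems B - {bzero B}" if "cluster B \<Gamma>"
  proof -
    have "\<Gamma> \<subseteq> elems B - {bzero B}"
      using that unfolding cluster_def t_clan_def clan_def by blast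
    moreover have "\<exists>b\<in>\<Gamma>. \<not> Ct B a b" if "a \<in> elems B" "a \<notin> \<Gamma>" for a
      using \<open>cluster B \<Gamma>\<close> that unfolding cluster_def by blast
    ultimately show ?thesis
      unfolding Ct by blast
  qed
  ultimately show ?thesis by blast
qed

section \<open>Morphisms and isomorphisms of dynamic contact algebras\<close>

lemma boolean_alg_closed:
  assumes "boolean_alg A"
  shows "bzero A \<in> elems A" "bone A \<in> elems A" "x \<in> elems A \<Longrightarrow> cmpl A x \<in> elems A"
    "\<lbrakk>x \<in> elems A; y \<in> elems A\<rbrakk> \<Longrightarrow> join A x y \<in> elems A"
    "\<lbrakk>x \<in> elems A; y \<in> elems A\<rbrakk> \<Longrightarrow> meet A x y \<in> elems A"
  using assms unfolding boolean_alg_def by blast+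

lemma boolean_hom_compose:
  assumes A: "boolean_alg A" and f: "boolean_hom A B f" and g: "boolean_hom B C g"
  shows "boolean_hom A C (compose (elems A) g f)"
proof -
  have "f x \<in> elems B" if "x \<in> elems A" for x
    using f that unfolding boolean_hom_def by blast
  moreover have "g y \<in> elems C" if "y \<in> elems B" for y
    using g that unfolding boolean_hom_def by blast
  ultimately show ?thesis
    using f g by (auto simp: boolean_hom_def compose_def boolean_alg_closed[OF A])
qed

lemma dca_morphism_compose:
  assumes A: "is_dca A" and f: "dca_morphism A B f" and g: "dca_morphism B C g"
  shows "dca_morphism A C (compose (elems A) g f)"
proof -
  have fB: "f x \<in> elems B" if "x \<in> elems A" for x
    using f that unfolding dca_morphism_def boolean_hom_def by blast
  have "boolean_hom A C (compose (elems A) g f)"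
    using assms unfolding is_dca_def dca_morphism_def by (blast intro: boolean_hom_compose)
  then show ?thesis
    using f g fB unfolding dca_morphism_def by (simp add: compose_def)
qed

lemma dca_morphism_id:
  assumes "is_dca A"
  shows "dca_morphism A A (\<lambda>x\<in>elems A. x)"
proof -
  have "boolean_alg A" using assms unfolding is_dca_def by blast
  then show ?thesis
    by (simp add: dca_morphism_def boolean_hom_def boolean_alg_closed)
qed

lemma is_category_DCA_trivial: "is_category (DCA_trivial K)"
proof -
  have ext: "f \<in> elems A \<rightarrow>\<^sub>E elems B" if "dca_morphism A B f" for A B :: "'a dca" and f
    using that unfolding dca_morphism_def boolean_hom_def by blast
  show ?thesis
    unfolding is_category_def DCA_trivial_def
  proof (simp, intro conjI allI impI)
    fix A :: "'a dca" assume "trivial_dca A \<and> elems A \<in> K"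
    then show "dca_morphism A A (\<lambda>x\<in>elems A. x)"
      by (simp add: dca_morphism_id trivial_dca_def)
  next
    fix A B C :: "'a dca" and f g
    assume "trivial_dca A \<and> elems A \<in> K" "dca_morphism A B f" "dca_morphism B C g"
    then show "dca_morphism A C (compose (elems A) g f)"
      by (simp add: dca_morphism_compose trivial_dca_def)
  next
    fix A B :: "'a dca" and f
    assume f: "dca_morphism A B f"
    show "compose (elems A) f (\<lambda>x\<in>elems A. x) = f" "compose (elems A) (\<lambda>x\<in>elems B. x) f = f"
      using ext[OF f] by (auto simp: compose_def PiE_iff extensional_def fun_eq_iff)
  next
    fix A B C D :: "'a dca" and f g h
    assume f: "dca_morphism A B f"
    show "compose (elems A) h (compose (elems A) g f) = compose (elems A) (compose (elems B) h g) f"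
      using ext[OF f] by (auto simp: compose_def PiE_iff fun_eq_iff)
  qed
qed

text \<open>Reflection is the right direction here: members of the preimage have related images, and
  relatedness must be brought back to A. The relations are parameters so that one proof covers
  t-clans and s-clans.\<close>

lemma clan_pullback:
  assumes A: "boolean_alg A" and f: "boolean_hom A B f"
    and R: "\<And>a b. \<lbrakk>a \<in> elems A; b \<in> elems A; R' (f a) (f b)\<rbrakk> \<Longrightarrow> R a b"
    and \<Gamma>: "clan B R' \<Gamma>"
  shows "clan A R {a \<in> elems A. f a \<in> \<Gamma>}"
proof -
  have fB: "f x \<in> elems B" if "x \<in> elems A" for x
    using f that unfolding boolean_hom_def by blast
  have up: "y \<in> \<Gamma>" if "x \<in> \<Gamma>" "y \<in> elems B" "leq B x y" for x y
    using \<Gamma> that unfolding clan_def by blast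
  have prime: "x \<in> \<Gamma> \<or> y \<in> \<Gamma>" if "x \<in> elems B" "y \<in> elems B" "join B x y \<in> \<Gamma>" for x y
    using \<Gamma> that unfolding clan_def by blast
  have leq: "leq B (f x) (f y)" if "x \<in> elems A" "y \<in> elems A" "leq A x y" for x y
    using f that unfolding leq_def boolean_hom_def by metis
  have f_join: "f (join A x y) = join B (f x) (f y)" if "x \<in> elems A" "y \<in> elems A" for x y
    using f that unfolding boolean_hom_def by blast
  have f_const: "f (bzero A) = bzero B" "f (bone A) = bone B"
    using f unfolding boolean_hom_def by blast+
  show ?thesis
    unfolding clan_def
  proof (intro conjI ballI impI)
    show "bone A \<in> {a \<in> elems A. f a \<in> \<Gamma>}" "bzero A \<notin> {a \<in> elems A. f a \<in> \<Gamma>}"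
      using \<Gamma> by (simp_all add: clan_def f_const boolean_alg_closed[OF A])
    show "y \<in> {a \<in> elems A. f a \<in> \<Gamma>}"
      if "x \<in> {a \<in> elems A. f a \<in> \<Gamma>}" "y \<in> elems A" "leq A x y" for x y
      using that up leq fB by blast
    show "x \<in> {a \<in> elems A. f a \<in> \<Gamma>} \<or> y \<in> {a \<in> elems A. f a \<in> \<Gamma>}"
      if "x \<in> elems A" "y \<in> elems A" "join A x y \<in> {a \<in> elems A. f a \<in> \<Gamma>}" for x y
      using that prime[of "f x" "f y"] fB f_join by auto
    show "R x y" if "x \<in> {a \<in> elems A. f a \<in> \<Gamma>}" "y \<in> {a \<in> elems A. f a \<in> \<Gamma>}" for x y
      using that R \<Gamma> unfolding clan_def by blast
  qed blast
qed

section \<open>Transport of structure along isomorphisms\<close>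

text \<open>B is not assumed to be a DCA; its axioms are derived from those of A.
  \<open>carrier\<close> is assumed because precontact relations must be false off the carrier,
  where the equivalences say nothing.\<close>

locale dca_iso =
  fixes A :: "'a dca" and B :: "'b dca" and \<phi> :: "'a \<Rightarrow> 'b"
  assumes A: "is_dca A"
    and bij: "bij_betw \<phi> (elems A) (elems B)"
    and zero: "bzero B = \<phi> (bzero A)"
    and one: "bone B = \<phi> (bone A)"
    and cmpl: "x \<in> elems A \<Longrightarrow> cmpl B (\<phi> x) = \<phi> (cmpl A x)"
    and join: "\<lbrakk>x \<in> elems A; y \<in> elems A\<rbrakk> \<Longrightarrow> join B (\<phi> x) (\<phi> y) = \<phi> (join A x y)"
    and meet: "\<lbrakk>x \<in> elems A; y \<in> elems A\<rbrakk> \<Longrightarrow> meet B (\<phi> x) (\<phi> y) = \<phi> (meet A x y)"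
    and Cs: "\<lbrakk>x \<in> elems A; y \<in> elems A\<rbrakk> \<Longrightarrow> Cs B (\<phi> x) (\<phi> y) \<longleftrightarrow> Cs A x y"
    and Ct: "\<lbrakk>x \<in> elems A; y \<in> elems A\<rbrakk> \<Longrightarrow> Ct B (\<phi> x) (\<phi> y) \<longleftrightarrow> Ct A x y"
    and Bp: "\<lbrakk>x \<in> elems A; y \<in> elems A\<rbrakk> \<Longrightarrow> Bp B (\<phi> x) (\<phi> y) \<longleftrightarrow> Bp A x y"
    and carrier: "Cs B u v \<or> Ct B u v \<or> Bp B u v \<Longrightarrow> u \<in> elems B \<and> v \<in> elems B"
begin

lemma boolean_alg_A: "boolean_alg A"
  using A unfolding is_dca_def by blast

lemmas closed_A [simp] = boolean_alg_closed[OF boolean_alg_A]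

lemma elems_B: "elems B = \<phi> ` elems A"
  using bij by (simp add: bij_betw_def)

lemma eq_iff [simp]: "\<lbrakk>x \<in> elems A; y \<in> elems A\<rbrakk> \<Longrightarrow> \<phi> x = \<phi> y \<longleftrightarrow> x = y"
  using bij by (auto simp: bij_betw_def inj_on_def)

lemma leq_B: "\<lbrakk>x \<in> elems A; y \<in> elems A\<rbrakk> \<Longrightarrow> leq B (\<phi> x) (\<phi> y) \<longleftrightarrow> leq A x y"
  by (simp add: leq_def join)

lemma boolean_alg_B: "boolean_alg B"
  unfolding boolean_alg_def elems_B
  by (simp add: zero one cmpl join meet) (use boolean_alg_A boolean_alg_def in blast)

lemma preimage:
  assumes "u \<in> elems B"
  obtains x where "x \<in> elems A" "u = \<phi> x"
  using assms elems_B by blast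

context
  fixes R :: "'a \<Rightarrow> 'a \<Rightarrow> bool" and R' :: "'b \<Rightarrow> 'b \<Rightarrow> bool"
  assumes R': "\<And>x y. \<lbrakk>x \<in> elems A; y \<in> elems A\<rbrakk> \<Longrightarrow> R' (\<phi> x) (\<phi> y) \<longleftrightarrow> R x y"
    and R'_carrier: "\<And>u v. R' u v \<Longrightarrow> u \<in> elems B \<and> v \<in> elems B"
begin

lemma precontact_B:
  assumes "precontact A R"
  shows "precontact B R'"
proof -
  have "u \<in> elems B \<and> v \<in> elems B \<and> u \<noteq> bzero B \<and> v \<noteq> bzero B" if uv: "R' u v" for u v
  proof -
    obtain x y where xy: "x \<in> elems A" "y \<in> elems A" "u = \<phi> x" "v = \<phi> y"
      using R'_carrier[OF uv] elems_B by blast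
    then have "x \<noteq> bzero A \<and> y \<noteq> bzero A"
      using uv assms R' unfolding precontact_def by blast
    then show ?thesis using xy by (simp add: zero elems_B)
  qed
  then have 1: "\<forall>u v. R' u v \<longrightarrow> u \<in> elems B \<and> v \<in> elems B \<and> u \<noteq> bzero B \<and> v \<noteq> bzero B"
    by blast
  have "R' u' v'"
    if el: "u \<in> elems B" "v \<in> elems B" "u' \<in> elems B" "v' \<in> elems B"
      and le: "leq B u u'" "leq B v v'" and uv: "R' u v" for u v u' v'
  proof -
    obtain x y x' y' where xy: "x \<in> elems A" "y \<in> elems A" "x' \<in> elems A" "y' \<in> elems A"
      "u = \<phi> x" "v = \<phi> y" "u' = \<phi> x'" "v' = \<phi> y'"
      using el by (meson preimage)
    then have "R x y" "leq A x x'" "leq A y y'"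
      using le uv by (simp_all add: leq_B R')
    then have "R x' y'"
      using assms xy unfolding precontact_def by blast
    then show ?thesis using xy by (simp add: R')
  qed
  then have 2: "\<forall>u\<in>elems B. \<forall>v\<in>elems B. \<forall>u'\<in>elems B. \<forall>v'\<in>elems B.
      R' u v \<and> leq B u u' \<and> leq B v v' \<longrightarrow> R' u' v'"
    by blast
  have "(R' u (join B v w) \<longrightarrow> R' u v \<or> R' u w) \<and>
      (R' (join B u v) w \<longrightarrow> R' u w \<or> R' v w)"
    if el: "u \<in> elems B" "v \<in> elems B" "w \<in> elems B" for u v w
  proof -
    obtain x y z where xyz: "x \<in> elems A" "y \<in> elems A" "z \<in> elems A"
      "u = \<phi> x" "v = \<phi> y" "w = \<phi> z"
      using el by (meson preimage)
    then have "(R x (join A y z) \<longrightarrow> R x y \<or> R x z) \<and> (R (join A x y) z \<longrightarrow> R x z \<or> R y z)"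
      using assms unfolding precontact_def by blast
    then show ?thesis using xyz by (simp add: join R')
  qed
  then have 3: "\<forall>u\<in>elems B. \<forall>v\<in>elems B. \<forall>w\<in>elems B.
      (R' u (join B v w) \<longrightarrow> R' u v \<or> R' u w) \<and> (R' (join B u v) w \<longrightarrow> R' u w \<or> R' v w)"
    by blast
  show ?thesis
    unfolding precontact_def by (intro conjI 1 2 3)
qed

lemma contact_B:
  assumes "contact A R"
  shows "contact B R'"
proof -
  have "precontact B R'"
    using assms precontact_B unfolding contact_def by blast
  moreover have "(R' u v \<longrightarrow> R' v u) \<and> (meet B u v \<noteq> bzero B \<longrightarrow> R' u v)"
    if el: "u \<in> elems B" "v \<in> elems B" for u v
  proof -
    obtain x y where xy: "x \<in> elems A" "y \<in> elems A" "u = \<phi> x" "v = \<phi> y"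
      using el by (meson preimage)
    then have "(R x y \<longrightarrow> R y x) \<and> (meet A x y \<noteq> bzero A \<longrightarrow> R x y)"
      using assms unfolding contact_def by blast
    then show ?thesis using xy by (simp add: meet zero R')
  qed
  ultimately show ?thesis
    unfolding contact_def by blast
qed

end

lemma is_dca_B: "is_dca B"
proof -
  have "contact B (Cs B)"
    by (rule contact_B[of _ "Cs A"]) (use Cs carrier A is_dca_def in blast)+
  moreover have "contact B (Ct B)"
    by (rule contact_B[of _ "Ct A"]) (use Ct carrier A is_dca_def in blast)+
  moreover have "precontact B (Bp B)"
    by (rule precontact_B[of _ "Bp A"]) (use Bp carrier A is_dca_def in blast)+
  ultimately show ?thesis
    using A boolean_alg_B unfolding is_dca_def elems_B by (simp add: cmpl Cs Ct Bp)
qed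

lemma trivial_B: "trivial_dca A \<Longrightarrow> trivial_dca B"
  using is_dca_B unfolding trivial_dca_def elems_B by (simp add: zero Ct Bp)

lemma morphism: "dca_morphism A B (restrict \<phi> (elems A))"
  unfolding dca_morphism_def boolean_hom_def elems_B
  by (simp add: zero one cmpl join meet Cs Ct Bp)

lemma inv_eq [simp]: "x \<in> elems A \<Longrightarrow> inv_into (elems A) \<phi> (\<phi> x) = x"
  using bij by (simp add: bij_betw_def)

lemma inverse_morphism: "dca_morphism B A (restrict (inv_into (elems A) \<phi>) (elems B))"
  unfolding dca_morphism_def boolean_hom_def elems_B
  by (auto simp add: zero one cmpl join meet Cs Ct Bp)

end

lemma dca_iso_comp:
  assumes "dca_iso A B \<phi>" "dca_iso B C \<psi>"
  shows "dca_iso A C (\<psi> \<circ> \<phi>)"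
proof -
  interpret f: dca_iso A B \<phi> by fact
  interpret g: dca_iso B C \<psi> by fact
  have B: "\<phi> x \<in> elems B" if "x \<in> elems A" for x
    using that f.elems_B by blast
  show ?thesis
    using bij_betw_trans[OF f.bij g.bij]
    by unfold_locales
      (simp_all add: f.A B f.zero f.one f.cmpl f.join f.meet f.Cs f.Ct f.Bp
        g.zero g.one g.cmpl g.join g.meet g.Cs g.Ct g.Bp g.carrier)
qed

lemma is_iso_DCA_trivial:
  assumes "dca_iso A B \<phi>" "A \<in> Ob (DCA_trivial K)" "B \<in> Ob (DCA_trivial K)"
  shows "is_iso (DCA_trivial K) A B (restrict \<phi> (elems A))"
proof -
  interpret dca_iso A B \<phi> by fact
  let ?\<psi> = "restrict (inv_into (elems A) \<phi>) (elems B)"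
  have "compose (elems A) ?\<psi> (restrict \<phi> (elems A)) = (\<lambda>x\<in>elems A. x)"
    "compose (elems B) (restrict \<phi> (elems A)) ?\<psi> = (\<lambda>x\<in>elems B. x)"
    by (auto simp: compose_def elems_B fun_eq_iff)
  then show ?thesis
    using morphism inverse_morphism unfolding is_iso_def DCA_trivial_def by auto
qed

text \<open>The membership tests confine the relations to the new carrier, since
  \<open>inv_into\<close> takes arbitrary values elsewhere.\<close>

definition transport :: "'a dca \<Rightarrow> ('a \<Rightarrow> 'b) \<Rightarrow> 'b dca" where
  "transport A e = (let d = inv_into (elems A) e in
    \<lparr>elems = e ` elems A, join = (\<lambda>u v. e (join A (d u) (d v))),
     meet = (\<lambda>u v. e (meet A (d u) (d v))), cmpl = (\<lambda>u. e (cmpl A (d u))),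
     bzero = e (bzero A), bone = e (bone A),
     Cs = (\<lambda>u v. u \<in> e ` elems A \<and> v \<in> e ` elems A \<and> Cs A (d u) (d v)),
     Ct = (\<lambda>u v. u \<in> e ` elems A \<and> v \<in> e ` elems A \<and> Ct A (d u) (d v)),
     Bp = (\<lambda>u v. u \<in> e ` elems A \<and> v \<in> e ` elems A \<and> Bp A (d u) (d v))\<rparr>)"

lemma dca_iso_transport:
  assumes "is_dca A" "inj_on e (elems A)"
  shows "dca_iso A (transport A e) e"
  using assms by unfold_locales (auto simp: transport_def Let_def bij_betw_def)

section \<open>Dual algebras of spaces\<close>

lemma dual_dca_simps [simp]:
  "elems (dual_dca S) = Ms S" "join (dual_dca S) = (\<union>)" "meet (dual_dca S) = rc_meet (Xt S)"
  "cmpl (dual_dca S) = rc_cmpl (Xt S)" "bzero (dual_dca S) = {}"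
  "bone (dual_dca S) = topspace (Xt S)"
  "Cs (dual_dca S) a b \<longleftrightarrow> a \<in> Ms S \<and> b \<in> Ms S \<and> a \<inter> b \<inter> Xs S \<noteq> {}"
  "Ct (dual_dca S) a b \<longleftrightarrow> a \<in> Ms S \<and> b \<in> Ms S \<and> a \<inter> b \<noteq> {}"
  "Bp (dual_dca S) a b \<longleftrightarrow> a \<in> Ms S \<and> b \<in> Ms S \<and> (\<exists>x\<in>a. \<exists>y\<in>b. prec S x y)"
  by (simp_all add: dual_dca_def)

lemma is_dmsD:
  assumes "is_dms S"
  shows "rc_subalgebra (Xt S) (Ms S)" "closed_base (Xt S) (Ms S)" "Xs S \<subseteq> topspace (Xt S)"
    "is_dca (dual_dca S)"
    "\<forall>x\<in>topspace (Xt S). \<forall>y\<in>topspace (Xt S).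
       prec S x y \<longleftrightarrow> (\<forall>a\<in>Ms S. \<forall>b\<in>Ms S. x \<in> a \<and> y \<in> b \<longrightarrow> Bp (dual_dca S) a b)"
  using assms unfolding is_dms_def by - (elim conjE, assumption)+

lemmas is_dca_dual = is_dmsD(4)

lemma Ms_subset: "\<lbrakk>is_dms S; a \<in> Ms S\<rbrakk> \<Longrightarrow> a \<subseteq> topspace (Xt S)"
  using is_dmsD(1)[of S] unfolding rc_subalgebra_def regular_closed_def by blast

text \<open>The order of the dual algebra is inclusion and its join is union, so upward closure and
  primality are set-theoretic; only relatedness depends on R.\<close>

lemma rho_clan:
  assumes S: "is_dms S" and x: "x \<in> topspace (Xt S)" and R: "\<And>a b. a \<in> rho S x \<Longrightarrow> b \<in> rho S x \<Longrightarrow> R a b"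
  shows "clan (dual_dca S) R (rho S x)"
proof -
  have "topspace (Xt S) \<in> Ms S"
    using is_dmsD(1)[OF S] unfolding rc_subalgebra_def by blast
  then show ?thesis
    using x R unfolding clan_def rho_def leq_def by auto
qed

lemma rho_t_clan:
  assumes "is_dms S" "x \<in> topspace (Xt S)"
  shows "t_clan (dual_dca S) (rho S x)"
  unfolding t_clan_def by (rule rho_clan[OF assms]) (auto simp: rho_def)

lemma rho_s_clan:
  assumes "is_dms S" "x \<in> Xs S"
  shows "s_clan (dual_dca S) (rho S x)"
  unfolding s_clan_def
proof (rule rho_clan)
  show "x \<in> topspace (Xt S)" using is_dmsD(3)[OF assms(1)] assms(2) by blast
qed (use assms in \<open>auto simp: rho_def\<close>)

text \<open>If an open set separates two points, its complement is an intersection of members of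
  \<open>Ms S\<close>, so some member separates them as well.\<close>

lemma rho_inj:
  assumes S: "is_dms S" and T0: "t0_space (Xt S)"
    and xy: "x \<in> topspace (Xt S)" "y \<in> topspace (Xt S)" and eq: "rho S x = rho S y"
  shows "x = y"
proof (rule ccontr)
  assume "x \<noteq> y"
  then obtain U where U: "openin (Xt S) U" "x \<notin> U \<longleftrightarrow> y \<in> U"
    using T0 xy unfolding t0_space_def by blast
  have "closedin (Xt S) (topspace (Xt S) - U)"
    using U(1) by blast
  with is_dmsD(2)[OF S] have "\<exists>N\<subseteq>Ms S. topspace (Xt S) - U = topspace (Xt S) \<inter> \<Inter>N"
    by (simp only: closed_base_def)
  then obtain N where N: "N \<subseteq> Ms S" "topspace (Xt S) - U = topspace (Xt S) \<inter> \<Inter>N"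
    by blast
  have "z \<notin> U \<longleftrightarrow> (\<forall>a\<in>N. z \<in> a)" if "z \<in> topspace (Xt S)" for z
    using arg_cong[OF N(2), of "(\<in>) z"] that by simp
  moreover have "x \<in> a \<longleftrightarrow> y \<in> a" if "a \<in> Ms S" for a
    using arg_cong[OF eq, of "(\<in>) a"] that by (simp add: rho_def)
  ultimately show False
    using U(2) xy N(1) by (meson subsetD)
qed

section \<open>Preimage maps of DMS-morphisms\<close>

definition preimage_map :: "'x dms \<Rightarrow> 'y dms \<Rightarrow> ('x \<Rightarrow> 'y) \<Rightarrow> 'y set \<Rightarrow> 'x set" where
  "preimage_map S1 S2 \<theta> = (\<lambda>a\<in>Ms S2. \<theta> -` a \<inter> topspace (Xt S1))"

lemma dms_morphismD:
  assumes "dms_morphism S1 S2 \<theta>"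
  shows "\<theta> \<in> topspace (Xt S1) \<rightarrow>\<^sub>E topspace (Xt S2)" "\<theta> ` Xs S1 \<subseteq> Xs S2"
    "\<lbrakk>x \<in> topspace (Xt S1); y \<in> topspace (Xt S1); prec S1 x y\<rbrakk> \<Longrightarrow> prec S2 (\<theta> x) (\<theta> y)"
    "boolean_hom (dual_dca S2) (dual_dca S1) (preimage_map S1 S2 \<theta>)"
  using assms unfolding dms_morphism_def preimage_map_def by blast+

text \<open>Reflection holds because \<open>\<theta>\<close> carries witnesses forward: a point in
  both preimages is sent to a common point, s-points go to s-points, and \<open>prec\<close> is
  preserved.\<close>

lemma preimage_map_morphism:
  assumes \<theta>: "dms_morphism S1 S2 \<theta>"
  shows "dca_morphism (dual_dca S2) (dual_dca S1) (preimage_map S1 S2 \<theta>)"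
  using dms_morphismD[OF \<theta>] unfolding dca_morphism_def by (auto simp: preimage_map_def) blast

lemma preimage_map_id:
  assumes "is_dms S"
  shows "preimage_map S S (\<lambda>x\<in>topspace (Xt S). x) = (\<lambda>a\<in>Ms S. a)"
  by (auto simp: preimage_map_def fun_eq_iff restrict_def dest: subsetD[OF Ms_subset[OF assms]])

lemma preimage_map_compose:
  assumes f: "dms_morphism S1 S2 f" and g: "dms_morphism S2 S3 g"
  shows "preimage_map S1 S3 (compose (topspace (Xt S1)) g f) =
    compose (Ms S3) (preimage_map S1 S2 f) (preimage_map S2 S3 g)"
proof -
  have "g -` a \<inter> topspace (Xt S2) \<in> Ms S2" if "a \<in> Ms S3" for a
    using dms_morphismD(4)[OF g] that unfolding boolean_hom_def preimage_map_def by fastforce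
  moreover have "f x \<in> topspace (Xt S2)" if "x \<in> topspace (Xt S1)" for x
    using dms_morphismD(1)[OF f] that by blast
  ultimately show ?thesis
    by (auto simp: preimage_map_def compose_def fun_eq_iff restrict_def)
qed

lemma dms_morphism_id: "is_dms S \<Longrightarrow> dms_morphism S S (\<lambda>x\<in>topspace (Xt S). x)"
  using preimage_map_id[of S] dca_morphism_id[OF is_dca_dual, of S] is_dmsD(3)[of S]
  unfolding dms_morphism_def dca_morphism_def preimage_map_def by auto

lemma dms_morphism_compose:
  assumes S: "is_dms S1" "is_dms S3" and f: "dms_morphism S1 S2 f" and g: "dms_morphism S2 S3 g"
  shows "dms_morphism S1 S3 (compose (topspace (Xt S1)) g f)"
proof -
  have f': "f x \<in> topspace (Xt S2)" if "x \<in> topspace (Xt S1)" for x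
    using dms_morphismD(1)[OF f] that by blast
  have g': "g x \<in> topspace (Xt S3)" if "x \<in> topspace (Xt S2)" for x
    using dms_morphismD(1)[OF g] that by blast
  have Xs: "Xs S1 \<subseteq> topspace (Xt S1)"
    by (rule is_dmsD(3)[OF S(1)])
  have "boolean_hom (dual_dca S3) (dual_dca S1)
      (preimage_map S1 S3 (compose (topspace (Xt S1)) g f))"
    unfolding preimage_map_compose[OF f g]
    using boolean_hom_compose[OF _ dms_morphismD(4)[OF g] dms_morphismD(4)[OF f]] is_dca_dual[OF S(2)]
    unfolding is_dca_def by simp
  moreover have "compose (topspace (Xt S1)) g f ` Xs S1 \<subseteq> Xs S3"
    using dms_morphismD(2)[OF f] dms_morphismD(2)[OF g] Xs by (force simp: compose_def)
  moreover have "compose (topspace (Xt S1)) g f \<in> topspace (Xt S1) \<rightarrow>\<^sub>E topspace (Xt S3)"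
    using f' g' by (simp add: compose_def)
  ultimately show ?thesis
    using dms_morphismD(3)[OF f] dms_morphismD(3)[OF g] f'
    unfolding dms_morphism_def preimage_map_def by (simp add: compose_def)
qed

lemma DMS_star_trivial_simps [simp]:
  "S \<in> Ob (DMS_star_trivial K) \<longleftrightarrow>
    trivial_dms S \<and> t0_space (Xt S) \<and> dm_compact S \<and> (\<exists>A\<in>K. Ms S \<approx> A)"
  "\<theta> \<in> Hom (DMS_star_trivial K) S1 S2 \<longleftrightarrow> dms_morphism S1 S2 \<theta>"
  "Idm (DMS_star_trivial K) S = (\<lambda>x\<in>topspace (Xt S). x)"
  "Comp (DMS_star_trivial K) S1 S2 S3 \<eta> \<theta> = compose (topspace (Xt S1)) \<eta> \<theta>"
  by (simp_all add: DMS_star_trivial_def)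

lemma is_category_DMS_star_trivial:
  "is_category (DMS_star_trivial K :: ('x dms, 'x \<Rightarrow> 'x) cat)"
proof -
  have ext: "f \<in> topspace (Xt S1) \<rightarrow>\<^sub>E topspace (Xt S2)" if "dms_morphism S1 S2 f"
    for S1 S2 :: "'x dms" and f
    using that unfolding dms_morphism_def by blast
  show ?thesis
    unfolding is_category_def
  proof (simp only: Ball_def DMS_star_trivial_simps, intro conjI allI impI; (elim conjE)?)
    fix S :: "'x dms" assume "trivial_dms S"
    then show "dms_morphism S S (\<lambda>x\<in>topspace (Xt S). x)"
      by (simp add: dms_morphism_id trivial_dms_def)
  next
    fix S1 S2 S3 :: "'x dms" and f g
    assume "trivial_dms S1" "trivial_dms S3" "dms_morphism S1 S2 f" "dms_morphism S2 S3 g"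
    then show "dms_morphism S1 S3 (compose (topspace (Xt S1)) g f)"
      by (simp add: dms_morphism_compose trivial_dms_def)
  next
    fix S1 S2 :: "'x dms" and f
    assume f: "dms_morphism S1 S2 f"
    show "compose (topspace (Xt S1)) f (\<lambda>x\<in>topspace (Xt S1). x) = f"
      "compose (topspace (Xt S1)) (\<lambda>x\<in>topspace (Xt S2). x) f = f"
      using ext[OF f] by (auto simp: compose_def PiE_iff extensional_def fun_eq_iff)
  next
    fix S1 S2 S3 S4 :: "'x dms" and f g h
    assume f: "dms_morphism S1 S2 f"
    show "compose (topspace (Xt S1)) h (compose (topspace (Xt S1)) g f) =
        compose (topspace (Xt S1)) (compose (topspace (Xt S2)) h g) f"
      using ext[OF f] by (auto simp: compose_def PiE_iff fun_eq_iff)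
  qed
qed

section \<open>Faithfulness and fullness of the preimage functor\<close>

text \<open>The preimage map determines which members of \<open>Ms S2\<close> contain
  \<open>\<theta> x\<close>, and in a \<open>t0_space\<close> these determine the point.\<close>

lemma preimage_map_inj:
  assumes S2: "is_dms S2" "t0_space (Xt S2)"
    and \<theta>: "dms_morphism S1 S2 \<theta>" and \<eta>: "dms_morphism S1 S2 \<eta>"
    and eq: "preimage_map S1 S2 \<theta> = preimage_map S1 S2 \<eta>"
  shows "\<theta> = \<eta>"
proof (rule PiE_ext[OF dms_morphismD(1)[OF \<theta>] dms_morphismD(1)[OF \<eta>]])
  fix x assume x: "x \<in> topspace (Xt S1)"
  then have xs: "\<theta> x \<in> topspace (Xt S2)" "\<eta> x \<in> topspace (Xt S2)"
    using dms_morphismD(1)[OF \<theta>] dms_morphismD(1)[OF \<eta>] by blast+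
  have "\<theta> x \<in> a \<longleftrightarrow> \<eta> x \<in> a" if "a \<in> Ms S2" for a
    using fun_cong[OF eq, of a] that x unfolding preimage_map_def by auto
  then have "rho S2 (\<theta> x) = rho S2 (\<eta> x)"
    unfolding rho_def by blast
  then show "\<theta> x = \<eta> x"
    by (rule rho_inj[OF S2 xs])
qed

lemma preimage_map_surj:
  assumes S1: "is_dms S1" and S2: "is_dms S2" "t0_space (Xt S2)" "dm_compact S2"
    and f: "dca_morphism (dual_dca S2) (dual_dca S1) f"
  shows "\<exists>\<theta>. dms_morphism S1 S2 \<theta> \<and> preimage_map S1 S2 \<theta> = f"
proof -
  have hom: "boolean_hom (dual_dca S2) (dual_dca S1) f"
    using f unfolding dca_morphism_def by blast
  have alg: "boolean_alg (dual_dca S2)"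
    using is_dca_dual[OF S2(1)] unfolding is_dca_def by blast
  have reflect: "Cs (dual_dca S1) (f a) (f b) \<Longrightarrow> Cs (dual_dca S2) a b"
    "Ct (dual_dca S1) (f a) (f b) \<Longrightarrow> Ct (dual_dca S2) a b"
    "Bp (dual_dca S1) (f a) (f b) \<Longrightarrow> Bp (dual_dca S2) a b"
    if "a \<in> Ms S2" "b \<in> Ms S2" for a b
    using f that unfolding dca_morphism_def dual_dca_simps(1) by blast+
  have fM: "f a \<in> Ms S1" if "a \<in> Ms S2" for a
    using hom that unfolding boolean_hom_def by auto
  define \<Gamma> where "\<Gamma> x = {a \<in> Ms S2. f a \<in> rho S1 x}" for x
  have t: "\<exists>y\<in>topspace (Xt S2). \<Gamma> x = rho S2 y" if x: "x \<in> topspace (Xt S1)" for x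
  proof -
    have "t_clan (dual_dca S2) {a \<in> elems (dual_dca S2). f a \<in> rho S1 x}"
      unfolding t_clan_def
      by (rule clan_pullback[OF alg hom _ rho_t_clan[OF S1 x, unfolded t_clan_def]])
        (use reflect(2) in \<open>simp only: dual_dca_simps(1)\<close>)
    then show ?thesis
      using S2(3) unfolding dm_compact_def \<Gamma>_def dual_dca_simps(1) by blast
  qed
  have s: "\<exists>y\<in>Xs S2. \<Gamma> x = rho S2 y" if x: "x \<in> Xs S1" for x
  proof -
    have "s_clan (dual_dca S2) {a \<in> elems (dual_dca S2). f a \<in> rho S1 x}"
      unfolding s_clan_def
      by (rule clan_pullback[OF alg hom _ rho_s_clan[OF S1 x, unfolded s_clan_def]])
        (use reflect(1) in \<open>simp only: dual_dca_simps(1)\<close>)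
    then show ?thesis
      using S2(3) unfolding dm_compact_def \<Gamma>_def dual_dca_simps(1) by blast
  qed
  define \<theta> where "\<theta> = (\<lambda>x\<in>topspace (Xt S1). SOME y. y \<in> topspace (Xt S2) \<and> \<Gamma> x = rho S2 y)"
  have \<theta>: "\<theta> x \<in> topspace (Xt S2)" "\<Gamma> x = rho S2 (\<theta> x)" if "x \<in> topspace (Xt S1)" for x
    using someI_ex[of "\<lambda>y. y \<in> topspace (Xt S2) \<and> \<Gamma> x = rho S2 y"] t[OF that] that
    unfolding \<theta>_def by auto
  \<comment> \<open>The defining property of \<open>\<theta>\<close> read elementwise; it says that
    the preimage of \<open>a\<close> is \<open>f a\<close>.\<close>
  have mem: "\<theta> x \<in> a \<longleftrightarrow> x \<in> f a" if "x \<in> topspace (Xt S1)" "a \<in> Ms S2" for x a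
    using arg_cong[OF \<theta>(2)[OF that(1)], of "(\<in>) a"] that(2) fM by (simp add: \<Gamma>_def rho_def)
  have "preimage_map S1 S2 \<theta> a = f a" for a
  proof (cases "a \<in> Ms S2")
    case True
    then show ?thesis
      using mem[OF _ True] Ms_subset[OF S1 fM[OF True]] by (auto simp: preimage_map_def)
  next
    case False
    then show ?thesis
      using hom unfolding boolean_hom_def preimage_map_def by (auto simp: PiE_def extensional_def)
  qed
  then have eq: "preimage_map S1 S2 \<theta> = f" by blast
  \<comment> \<open>\<open>\<theta> x\<close> was chosen only among the points of the whole space.
    The pulled-back s-clan is also realised by a point of \<open>Xs S2\<close>, and the two points
    agree by \<open>rho_inj\<close>.\<close>
  have "\<theta> x \<in> Xs S2" if x: "x \<in> Xs S1" for x
  proof -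
    have x': "x \<in> topspace (Xt S1)" using is_dmsD(3)[OF S1] x by blast
    obtain y where y: "y \<in> Xs S2" "\<Gamma> x = rho S2 y" using s[OF x] by blast
    then have "y \<in> topspace (Xt S2)" using is_dmsD(3)[OF S2(1)] by blast
    then have "\<theta> x = y"
      using rho_inj[OF S2(1,2) \<theta>(1)[OF x']] \<theta>(2)[OF x'] y(2) by simp
    then show ?thesis using y by simp
  qed
  moreover have "prec S2 (\<theta> x) (\<theta> y)"
    if xy: "x \<in> topspace (Xt S1)" "y \<in> topspace (Xt S1)" "prec S1 x y" for x y
  proof -
    \<comment> \<open>The pair \<open>x\<close>, \<open>y\<close> witnesses \<open>Bp\<close>
      between \<open>f a\<close> and \<open>f b\<close>, which \<open>f\<close> reflects. Since
      \<open>prec\<close> is determined by \<open>Bp\<close> in a DMS, this suffices.\<close>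
    have "Bp (dual_dca S2) a b" if "a \<in> Ms S2" "b \<in> Ms S2" "\<theta> x \<in> a" "\<theta> y \<in> b" for a b
      using reflect(3)[OF that(1,2)] mem that xy fM by auto
    then show ?thesis
      using bspec[OF bspec[OF is_dmsD(5)[OF S2(1)] \<theta>(1)[OF xy(1)]] \<theta>(1)[OF xy(2)]]
      by (simp del: dual_dca_simps)
  qed
  moreover have "\<theta> \<in> topspace (Xt S1) \<rightarrow>\<^sub>E topspace (Xt S2)"
    by (rule PiE_I) (simp_all add: \<theta>(1), simp add: \<theta>_def)
  moreover have "boolean_hom (dual_dca S2) (dual_dca S1) (preimage_map S1 S2 \<theta>)"
    using eq hom by simp
  ultimately have "dms_morphism S1 S2 \<theta>"
    unfolding dms_morphism_def preimage_map_def by blast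
  then show ?thesis using eq by blast
qed

lemma dual_trivial:
  assumes S: "trivial_dms S" and comp: "dm_compact S"
  shows "trivial_dca (dual_dca S)"
proof -
  have dms: "is_dms S" and dca: "is_dca (dual_dca S)"
    using S is_dca_dual unfolding trivial_dms_def by blast+
  interpret carrier_boolalg "dual_dca S"
    using dca by unfold_locales (simp add: is_dca_def)
  obtain t0 where t0: "Tm S = {t0}" "prec S t0 t0"
    using S unfolding trivial_dms_def by blast
  have "t0 \<in> a" if a: "a \<in> Ms S" "a \<noteq> {}" for a
  proof -
    have "\<not> leq (dual_dca S) a {}"
      using a by (simp add: leq_def)
    then obtain U where U: "prime_filter U" "a \<in> U"
      using prime_filter_separates[of a "{}"] a(1) closed(1) by auto
    then have "cluster (dual_dca S) {x \<in> elems (dual_dca S). \<forall>u\<in>U. Ct (dual_dca S) x u}"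
      "a \<in> {x \<in> elems (dual_dca S). \<forall>u\<in>U. Ct (dual_dca S) x u}"
      using cluster_of_prime_filter[OF dca U(1)] by blast+
    then have "a \<in> rho S t0"
      using comp t0(1) unfolding dm_compact_def by auto
    then show ?thesis unfolding rho_def by blast
  qed
  then show ?thesis
    using dca t0(2) unfolding trivial_dca_def by auto
qed

section \<open>The space of t-clans\<close>

text \<open>The points are a copy \<open>X\<close> of the set of t-clans inside the given type; \<open>cl\<close> reads off the
  t-clan of a point.\<close>

locale canonical_space =
  fixes B :: "'a dca" and X :: "'x set" and cl :: "'x \<Rightarrow> 'a set"
  assumes trivial: "trivial_dca B" and cl: "bij_betw cl X {\<Gamma>. t_clan B \<Gamma>}"
begin

lemma is_dca: "is_dca B"
  using trivial unfolding trivial_dca_def by blast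

sublocale carrier_boolalg B
  using is_dca by unfold_locales (simp add: is_dca_def)

lemma contacts: "contact B (Cs B)" "contact B (Ct B)"
  using is_dca unfolding is_dca_def by blast+

lemma related_nonzero:
  "Ct B a b \<longleftrightarrow> a \<in> elems B - {bzero B} \<and> b \<in> elems B - {bzero B}"
  "Bp B a b \<longleftrightarrow> a \<in> elems B - {bzero B} \<and> b \<in> elems B - {bzero B}"
proof -
  have nonzero: "a \<in> elems B - {bzero B} \<and> b \<in> elems B - {bzero B}"
    if "precontact B R" "R a b" for R
    using that unfolding precontact_def by blast
  have "precontact B (Ct B)" "precontact B (Bp B)"
    using is_dca unfolding is_dca_def contact_def by blast+
  moreover have "Ct B a b \<and> Bp B a b" if "a \<in> elems B - {bzero B} \<and> b \<in> elems B - {bzero B}"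
    using trivial that unfolding trivial_dca_def by blast
  ultimately show "Ct B a b \<longleftrightarrow> a \<in> elems B - {bzero B} \<and> b \<in> elems B - {bzero B}"
    "Bp B a b \<longleftrightarrow> a \<in> elems B - {bzero B} \<and> b \<in> elems B - {bzero B}"
    using nonzero by metis+
qed

lemma s_clan_t_clan:
  assumes "s_clan B \<Gamma>"
  shows "t_clan B \<Gamma>"
proof -
  have "Ct B a b" if "a \<in> elems B" "b \<in> elems B" "Cs B a b" for a b
    using is_dca that unfolding is_dca_def by blast
  then show ?thesis
    using assms unfolding s_clan_def t_clan_def clan_def by (meson subsetD)
qed

lemma point:
  assumes "t_clan B \<Gamma>"
  obtains x where "x \<in> X" "cl x = \<Gamma>"
proof -
  have "\<Gamma> \<in> cl ` X"
    using bij_betw_imp_surj_on[OF cl] assms by simp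
  then show ?thesis using that by blast
qed

text \<open>The source of s-points: whatever is separated by a prime filter is separated inside
  \<open>Xs\<close> of the dual space.\<close>

lemma prime_filter_point:
  assumes "prime_filter U"
  obtains x where "x \<in> X" "cl x = U" "s_clan B (cl x)"
  using point[of U] prime_filter_clan[OF assms contacts(1)] prime_filter_clan[OF assms contacts(2)]
  unfolding s_clan_def t_clan_def by blast

lemma cl_clan:
  assumes "x \<in> X"
  shows "t_clan B (cl x)" "grill (cl x)" "bone B \<in> cl x"
proof -
  show "t_clan B (cl x)"
    using bij_betwE[OF cl] assms by blast
  then show "grill (cl x)" "bone B \<in> cl x"
    unfolding t_clan_def clan_iff by simp_all
qed

lemma cl_subset: "x \<in> X \<Longrightarrow> cl x \<subseteq> elems B"
  using cl_clan(2) unfolding grill_def by blast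

text \<open>The analogue of the Stone map. A clan need not be closed under meets, so joins become
  unions while meets become only the regularised intersections \<open>rc_meet\<close>.\<close>

definition h :: "'a \<Rightarrow> 'x set" where
  "h a = {x \<in> X. a \<in> cl x}"

lemma h_subset: "h a \<subseteq> X"
  by (auto simp: h_def)

lemma h_zero: "h (bzero B) = {}" and h_one: "h (bone B) = X"
  using cl_clan by (auto simp: h_def grill_def)

lemma cl_join: "\<lbrakk>x \<in> X; a \<in> elems B; b \<in> elems B\<rbrakk> \<Longrightarrow> a \<squnion> b \<in> cl x \<longleftrightarrow> a \<in> cl x \<or> b \<in> cl x"
  using cl_clan(2)[of x] leq_join[of a b] closed(4)[of a b] unfolding grill_def by blast

lemma h_join: "\<lbrakk>a \<in> elems B; b \<in> elems B\<rbrakk> \<Longrightarrow> h (a \<squnion> b) = h a \<union> h b"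
  using cl_join by (auto simp: h_def)

lemma h_separates:
  assumes "a \<in> elems B" "b \<in> elems B" "\<not> a \<sqsubseteq> b"
  obtains x where "x \<in> h a" "x \<notin> h b" "s_clan B (cl x)"
proof -
  obtain U where U: "prime_filter U" "a \<in> U" "b \<notin> U"
    using prime_filter_separates[OF assms] by blast
  then obtain x where "x \<in> X" "cl x = U" "s_clan B (cl x)"
    using prime_filter_point by blast
  then show ?thesis
    using U by (intro that[of x]) (simp_all add: h_def)
qed

lemma h_eq_iff: "\<lbrakk>a \<in> elems B; b \<in> elems B\<rbrakk> \<Longrightarrow> h a = h b \<longleftrightarrow> a = b"
  by (metis h_separates leq_antisym)

lemma inj_h: "inj_on h (elems B)"
  by (simp add: inj_on_def h_eq_iff)

lemma h_nonempty: "a \<in> elems B \<Longrightarrow> a \<noteq> bzero B \<Longrightarrow> h a \<noteq> {}"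
  using h_eq_iff[of a "bzero B"] h_zero by simp

section \<open>The topology with the sets \<open>h a\<close> as closed base\<close>

text \<open>The complements of the sets \<open>h a\<close> can serve as an open base because
  \<open>h\<close> turns joins into unions, so they are closed under finite intersections.\<close>

definition space :: "'x topology" where
  "space = topology (\<lambda>U. U \<subseteq> X \<and> (\<forall>x\<in>U. \<exists>a\<in>elems B. x \<in> X - h a \<and> X - h a \<subseteq> U))"

lemma openin_space:
  "openin space U \<longleftrightarrow> U \<subseteq> X \<and> (\<forall>x\<in>U. \<exists>a\<in>elems B. x \<in> X - h a \<and> X - h a \<subseteq> U)"
proof -
  let ?P = "\<lambda>U. U \<subseteq> X \<and> (\<forall>x\<in>U. \<exists>a\<in>elems B. x \<in> X - h a \<and> X - h a \<subseteq> U)"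
  have "?P (U \<inter> V)" if U: "?P U" and V: "?P V" for U V
  proof -
    have "\<exists>c\<in>elems B. x \<in> X - h c \<and> X - h c \<subseteq> U \<inter> V" if x: "x \<in> U \<inter> V" for x
    proof -
      obtain a where a: "a \<in> elems B" "x \<in> X - h a" "X - h a \<subseteq> U" using U x by blast
      obtain b where b: "b \<in> elems B" "x \<in> X - h b" "X - h b \<subseteq> V" using V x by blast
      have "x \<in> X - h (a \<squnion> b) \<and> X - h (a \<squnion> b) \<subseteq> U \<inter> V"
        unfolding h_join[OF a(1) b(1)] using a b by blast
      then show ?thesis using closed(4)[OF a(1) b(1)] by blast
    qed
    then show ?thesis using U by blast
  qed
  moreover have "?P (\<Union>\<K>)" if \<K>: "\<forall>K\<in>\<K>. ?P K" for \<K>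
  proof -
    have "\<exists>a\<in>elems B. x \<in> X - h a \<and> X - h a \<subseteq> \<Union>\<K>" if x: "x \<in> K" "K \<in> \<K>" for x K
    proof -
      obtain a where "a \<in> elems B" "x \<in> X - h a" "X - h a \<subseteq> K"
        using \<K> x by blast
      then show ?thesis using x(2) by blast
    qed
    then show ?thesis using \<K> by blast
  qed
  ultimately have "istopology ?P"
    unfolding istopology_def by blast
  then show ?thesis
    by (simp add: space_def topology_inverse')
qed

lemma open_basic: "a \<in> elems B \<Longrightarrow> openin space (X - h a)"
  unfolding openin_space by blast

lemma topspace_space [simp]: "topspace space = X"
proof
  show "topspace space \<subseteq> X"
    using openin_topspace[of space] unfolding openin_space by blast
  have "openin space X"
    using open_basic[of "bzero B"] by (simp add: h_zero)
  then show "X \<subseteq> topspace space" by (rule openin_subset)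
qed

lemma closed_h: "a \<in> elems B \<Longrightarrow> closedin space (h a)"
  unfolding closedin_def using open_basic[of a] h_subset by simp

text \<open>The computation from which interiors, regular closedness and the algebra operations
  follow. If \<open>X - h b\<close> is a neighbourhood of a point of \<open>h (cmpl B a)\<close>,
  then \<open>cmpl B a\<close> is not below \<open>b\<close>, so \<open>a\<close> and
  \<open>b\<close> do not cover the unit and some point avoids both \<open>h a\<close> and
  \<open>h b\<close>.\<close>

lemma closure_basic:
  assumes a: "a \<in> elems B"
  shows "space closure_of (X - h a) = h (cmpl B a)"
proof
  have "h a \<union> h (cmpl B a) = X"
    using h_join[OF a closed(3)[OF a]] a by (simp add: h_one)
  then show "space closure_of (X - h a) \<subseteq> h (cmpl B a)"
    using closed_h[OF closed(3)[OF a]] by (intro closure_of_minimal) blast+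
  show "h (cmpl B a) \<subseteq> space closure_of (X - h a)"
  proof
    fix x assume x: "x \<in> h (cmpl B a)"
    have "\<exists>y\<in>X - h a. y \<in> U" if U: "x \<in> U" "openin space U" for U
    proof -
      obtain b where b: "b \<in> elems B" "x \<in> X - h b" "X - h b \<subseteq> U"
        using U unfolding openin_space by blast
      have "\<not> cmpl B a \<sqsubseteq> b"
        using cl_clan(2)[of x] x b(1,2) unfolding h_def grill_def by blast
      then have "a \<squnion> b \<noteq> bone B"
        using a b by (simp add: cmpl_leq_iff)
      then have "\<not> bone B \<sqsubseteq> a \<squnion> b"
        using a b leq_antisym[of "a \<squnion> b" "bone B"] by auto
      then obtain y where "y \<in> h (bone B)" "y \<notin> h (a \<squnion> b)"
        using h_separates[of "bone B" "a \<squnion> b"] a b by auto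
      then show ?thesis
        using b(3) unfolding h_join[OF a b(1)] h_one by blast
    qed
    then show "x \<in> space closure_of (X - h a)"
      using x h_subset unfolding in_closure_of topspace_space by blast
  qed
qed

lemma interior_h: "a \<in> elems B \<Longrightarrow> space interior_of (h a) = X - h (cmpl B a)"
  by (simp add: interior_of_closure_of closure_basic)

lemma regular_closed_h: "a \<in> elems B \<Longrightarrow> regular_closed space (h a)"
  using closure_basic[of "cmpl B a"] by (simp add: regular_closed_def h_subset interior_h)

lemma rc_cmpl_h: "a \<in> elems B \<Longrightarrow> rc_cmpl space (h a) = h (cmpl B a)"
  by (simp add: rc_cmpl_def closure_basic)

lemma rc_meet_h:
  assumes "a \<in> elems B" "b \<in> elems B"
  shows "rc_meet space (h a) (h b) = h (a \<sqinter> b)"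
proof -
  \<comment> \<open>Interior commutes with binary intersection, so the two known interiors combine
    into a single basic open set.\<close>
  have "space interior_of (h a \<inter> h b) = X - h (cmpl B a \<squnion> cmpl B b)"
    using assms by (simp add: interior_of_Int interior_h h_join) blast
  then show ?thesis
    using assms by (simp add: rc_meet_def closure_basic cmpl_join_cmpl)
qed

text \<open>In a trivial algebra all members of any two clans are related by the precontact relation,
  so every point precedes every point.\<close>

definition dual :: "'x dms" where
  "dual = \<lparr>Xt = space, Xs = {x \<in> X. s_clan B (cl x)}, Tm = {x \<in> X. cluster B (cl x)},
     prec = (\<lambda>x y. x \<in> X \<and> y \<in> X), Ms = h ` elems B\<rparr>"

lemma dual_simps [simp]:
  "Xt dual = space" "Xs dual = {x \<in> X. s_clan B (cl x)}" "Tm dual = {x \<in> X. cluster B (cl x)}"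
  "prec dual x y \<longleftrightarrow> x \<in> X \<and> y \<in> X" "Ms dual = h ` elems B"
  by (simp_all add: dual_def)

section \<open>The dual space is a trivial DM-compact space\<close>

lemma cluster_point:
  obtains t where "t \<in> X" "cl t = elems B - {bzero B}" "Tm dual = {t}"
proof -
  have cluster: "cluster B (elems B - {bzero B})"
    using trivial_cluster_iff[OF trivial] by blast
  then obtain t where t: "t \<in> X" "cl t = elems B - {bzero B}"
    using point unfolding cluster_def by blast
  have "x = t" if "x \<in> X" "cluster B (cl x)" for x
    using that t inj_onD[OF bij_betw_imp_inj_on[OF cl], of x t] trivial_cluster_iff[OF trivial]
    by simp
  moreover have "cluster B (cl t)"
    using t(2) cluster by simp
  ultimately have "Tm dual = {t}"
    using t(1) unfolding dual_simps by blast
  then show ?thesis using t that by blast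
qed

text \<open>Contact \<open>Cs\<close> is witnessed by an s-clan through both elements,
  \<open>Ct\<close> by the cluster point, and \<open>Bp\<close> by any points of the two nonempty
  sets. The DCA axioms for the dual algebra then come by transport.\<close>

lemma iso: "dca_iso B (dual_dca dual) h"
proof
  show "is_dca B" by (rule is_dca)
  show "bij_betw h (elems B) (elems (dual_dca dual))"
    using inj_h by (simp add: bij_betw_def)
  show "bzero (dual_dca dual) = h (bzero B)" "bone (dual_dca dual) = h (bone B)"
    by (simp_all add: h_zero h_one)
  fix a assume a: "a \<in> elems B"
  then show "cmpl (dual_dca dual) (h a) = h (cmpl B a)"
    by (simp add: rc_cmpl_h)
  fix b assume b: "b \<in> elems B"
  show "join (dual_dca dual) (h a) (h b) = h (join B a b)"
    using a b by (simp add: h_join)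
  show "meet (dual_dca dual) (h a) (h b) = h (meet B a b)"
    using a b by (simp add: rc_meet_h)
  have zero_iff: "h c = {} \<longleftrightarrow> c = bzero B" if "c \<in> elems B" for c
    using h_nonempty[OF that] h_zero by blast
  show "Cs (dual_dca dual) (h a) (h b) \<longleftrightarrow> Cs B a b"
  proof
    assume "Cs (dual_dca dual) (h a) (h b)"
    then obtain x where x: "a \<in> cl x" "b \<in> cl x" "s_clan B (cl x)"
      by (auto simp: h_def)
    then show "Cs B a b"
      unfolding s_clan_def clan_iff by simp
  next
    assume "Cs B a b"
    then obtain \<Gamma> where \<Gamma>: "s_clan B \<Gamma>" "a \<in> \<Gamma>" "b \<in> \<Gamma>"
      using clan_exists[OF contacts(1)] unfolding s_clan_def by blast
    then obtain x where "x \<in> X" "cl x = \<Gamma>"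
      using point s_clan_t_clan by blast
    then have "x \<in> h a \<inter> h b \<inter> Xs dual"
      using \<Gamma> by (simp add: h_def)
    then show "Cs (dual_dca dual) (h a) (h b)"
      using a b by auto
  qed
  show "Ct (dual_dca dual) (h a) (h b) \<longleftrightarrow> Ct B a b"
  proof
    assume "Ct (dual_dca dual) (h a) (h b)"
    then show "Ct B a b"
      using a b h_zero by (auto simp: related_nonzero)
  next
    assume "Ct B a b"
    moreover obtain t where "t \<in> X" "cl t = elems B - {bzero B}"
      by (rule cluster_point)
    ultimately have "t \<in> h a \<inter> h b"
      by (simp add: related_nonzero h_def)
    then show "Ct (dual_dca dual) (h a) (h b)"
      using a b by auto
  qed
  show "Bp (dual_dca dual) (h a) (h b) \<longleftrightarrow> Bp B a b"
    using a b zero_iff h_subset[of a] h_subset[of b] by (auto simp: related_nonzero) blast+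
next
  fix u v
  assume "Cs (dual_dca dual) u v \<or> Ct (dual_dca dual) u v \<or> Bp (dual_dca dual) u v"
  then show "u \<in> elems (dual_dca dual) \<and> v \<in> elems (dual_dca dual)"
    by auto
qed

sublocale iso: dca_iso B "dual_dca dual" h
  by (rule iso)

lemma rho_eq: "x \<in> X \<Longrightarrow> rho dual x = h ` cl x"
  using cl_clan(2)[of x] by (auto simp: rho_def h_def grill_def)

lemma rc_subalgebra_dual: "rc_subalgebra space (h ` elems B)"
proof -
  have "{} \<in> h ` elems B" "X \<in> h ` elems B"
    using h_zero h_one closed(1,2) by (metis imageI)+
  moreover have "h a \<union> h b \<in> h ` elems B" if "a \<in> elems B" "b \<in> elems B" for a b
    using h_join[OF that] closed(4)[OF that] by (metis imageI)
  ultimately show ?thesis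
    unfolding rc_subalgebra_def by (auto simp: regular_closed_h rc_cmpl_h rc_meet_h)
qed

lemma closed_base_dual: "closed_base space (h ` elems B)"
  unfolding closed_base_def
proof (intro conjI allI impI)
  show "\<forall>a\<in>h ` elems B. closedin space a"
    using closed_h by blast
  fix F assume F: "closedin space F"
  \<comment> \<open>All basic closed sets around F. A point outside F has a basic neighbourhood
    \<open>X - h a\<close> missing F, and then \<open>h a\<close> belongs to this family.\<close>
  let ?N = "{c \<in> h ` elems B. F \<subseteq> c}"
  have "x \<in> F" if x: "x \<in> X" "x \<in> \<Inter>?N" for x
  proof (rule ccontr)
    assume "x \<notin> F"
    then have "x \<in> X - F" "openin space (X - F)"
      using x F unfolding closedin_def by auto
    then obtain a where a: "a \<in> elems B" "x \<in> X - h a" "X - h a \<subseteq> X - F"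
      unfolding openin_space by blast
    moreover have "F \<subseteq> X"
      using closedin_subset[OF F] by simp
    ultimately have "F \<subseteq> h a" by blast
    then show False using x a by blast
  qed
  then have "F = topspace space \<inter> \<Inter>?N"
    using closedin_subset[OF F] by (intro equalityI) (simp_all add: subset_iff Inter_iff)
  then show "\<exists>N\<subseteq>h ` elems B. F = topspace space \<inter> \<Inter>N"
    by (intro exI[of _ ?N] conjI Collect_restrict)
qed

text \<open>The interior contains a nonempty basic open set \<open>X - h a\<close>. Then
  \<open>a\<close> is not the unit, and a prime filter omitting \<open>a\<close> is an s-point in
  that set.\<close>

lemma regular_closed_meets_Xs:
  assumes "regular_closed space c" "c \<noteq> {}"
  shows "c \<inter> Xs dual \<noteq> {}"
proof -
  have c: "space closure_of (space interior_of c) = c"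
    using assms unfolding regular_closed_def by blast
  then have "space interior_of c \<noteq> {}"
    using assms(2) closure_of_empty by metis
  then obtain x a where a: "a \<in> elems B" "x \<in> X - h a" "X - h a \<subseteq> space interior_of c"
    using openin_interior_of[of space c] unfolding openin_space by blast
  then have "\<not> bone B \<sqsubseteq> a"
    using leq_antisym[of a "bone B"] h_one by auto
  then obtain y where "y \<in> X - h a" "s_clan B (cl y)"
    using h_separates[of "bone B" a] a(1) h_one by auto
  moreover have "space interior_of c \<subseteq> c"
    by (rule interior_of_subset)
  ultimately show ?thesis using a(3) by auto
qed

text \<open>The dual algebra is trivial by transport, so its only cluster consists of its nonempty
  members, and these are the ones containing \<open>t\<close>.\<close>

lemma cluster_rho:
  assumes t: "t \<in> X" "cl t = elems B - {bzero B}"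
  shows "cluster (dual_dca dual) \<Gamma> \<longleftrightarrow> \<Gamma> = rho dual t"
proof -
  have "rho dual t = elems (dual_dca dual) - {bzero (dual_dca dual)}"
    using inj_on_image_set_diff[OF inj_h, of "elems B" "{bzero B}"] closed(1)
    by (simp add: rho_eq t h_zero)
  then show ?thesis
    by (simp only: trivial_cluster_iff[OF iso.trivial_B[OF trivial]])
qed

lemma is_dms_dual: "is_dms dual"
proof -
  obtain t where t: "t \<in> X" "cl t = elems B - {bzero B}" "Tm dual = {t}"
    by (rule cluster_point)
  have "\<not> bone B \<sqsubseteq> bzero B"
    using zero_neq_one leq_antisym[of "bone B" "bzero B"] by auto
  then obtain x where "x \<in> X" "s_clan B (cl x)"
    using h_separates[of "bone B" "bzero B"] h_one by auto
  then have Xs: "Xs dual \<noteq> {}" by auto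
  \<comment> \<open>Since \<open>prec\<close> is total on the points, its characterisation by
    \<open>Bp\<close> amounts to this.\<close>
  have "Bp (dual_dca dual) c d" if "c \<in> Ms dual" "d \<in> Ms dual" "x \<in> c" "y \<in> d" for c d x y
    using that h_subset by auto
  moreover have "cluster (dual_dca dual) (rho dual s)" if "s \<in> Tm dual" for s
    using that cluster_rho[OF t(1,2)] unfolding t(3) by simp
  ultimately show ?thesis
    unfolding is_dms_def
    using rc_subalgebra_dual closed_base_dual Xs t(1,3) regular_closed_meets_Xs iso.is_dca_B
    by (simp del: dual_dca_simps) blast
qed

lemma trivial_dms_dual: "trivial_dms dual"
proof -
  obtain t where "t \<in> X" "Tm dual = {t}"
    by (rule cluster_point)
  then show ?thesis
    unfolding trivial_dms_def using is_dms_dual by (simp del: dual_simps(3))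
qed

lemma t0_dual: "t0_space (Xt dual)"
  unfolding t0_space_def
proof (intro ballI impI)
  fix x y assume xy: "x \<in> topspace (Xt dual)" "y \<in> topspace (Xt dual)" "x \<noteq> y"
  then have "cl x \<noteq> cl y"
    using inj_onD[OF bij_betw_imp_inj_on[OF cl], of x y] by auto
  then obtain a where a: "a \<in> cl x \<union> cl y" "a \<in> cl x \<longleftrightarrow> a \<notin> cl y"
    by blast
  then have "a \<in> elems B"
    using cl_subset xy by auto
  then have "openin space (X - h a)" by (rule open_basic)
  moreover have "x \<notin> X - h a \<longleftrightarrow> y \<in> X - h a"
    using a xy by (auto simp: h_def)
  ultimately show "\<exists>U. openin (Xt dual) U \<and> (x \<notin> U) = (y \<in> U)"
    by auto
qed

lemma rho_of_preimage:
  assumes "\<Gamma> \<subseteq> Ms dual" "x \<in> X" "cl x = {a \<in> elems B. h a \<in> \<Gamma>}"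
  shows "\<Gamma> = rho dual x"
  using assms rho_eq[OF assms(2)] by auto

text \<open>Clans of the dual algebra are pulled back along \<open>h\<close> to clans of B, which
  are points by construction; clusters are settled by their uniqueness.\<close>

lemma dm_compact_dual: "dm_compact dual"
  unfolding dm_compact_def
proof (intro conjI allI impI)
  have hom: "boolean_hom B (dual_dca dual) (restrict h (elems B))"
    using iso.morphism unfolding dca_morphism_def by blast
  have preimage: "{a \<in> elems B. restrict h (elems B) a \<in> \<Gamma>} = {a \<in> elems B. h a \<in> \<Gamma>}" for \<Gamma>
    by auto
  note pullback = clan_pullback[OF boolean_alg hom, unfolded preimage]
  fix \<Gamma>
  show "\<exists>x\<in>topspace (Xt dual). \<Gamma> = rho dual x" if \<Gamma>: "t_clan (dual_dca dual) \<Gamma>"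
  proof -
    have "t_clan B {a \<in> elems B. h a \<in> \<Gamma>}"
      unfolding t_clan_def
      by (rule pullback[OF _ \<Gamma>[unfolded t_clan_def]]) (simp add: iso.Ct del: dual_dca_simps)
    then obtain x where "x \<in> X" "cl x = {a \<in> elems B. h a \<in> \<Gamma>}"
      by (rule point)
    then show ?thesis
      using rho_of_preimage[of \<Gamma> x] \<Gamma> unfolding t_clan_def clan_def by auto
  qed
  show "\<exists>x\<in>Xs dual. \<Gamma> = rho dual x" if \<Gamma>: "s_clan (dual_dca dual) \<Gamma>"
  proof -
    have s: "s_clan B {a \<in> elems B. h a \<in> \<Gamma>}"
      unfolding s_clan_def
      by (rule pullback[OF _ \<Gamma>[unfolded s_clan_def]]) (simp add: iso.Cs del: dual_dca_simps)
    then obtain x where "x \<in> X" "cl x = {a \<in> elems B. h a \<in> \<Gamma>}"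
      by (rule point[OF s_clan_t_clan])
    then show ?thesis
      using rho_of_preimage[of \<Gamma> x] s \<Gamma> unfolding s_clan_def[of "dual_dca dual"] clan_def by auto
  qed
  show "\<exists>x\<in>Tm dual. \<Gamma> = rho dual x" if "cluster (dual_dca dual) \<Gamma>"
  proof -
    obtain t where "t \<in> X" "cl t = elems B - {bzero B}" "Tm dual = {t}"
      by (rule cluster_point)
    then show ?thesis
      using cluster_rho that by (simp del: dual_simps)
  qed
qed

end

text \<open>T-clans are subsets of the carrier, so an injection of its power set into
  \<open>'x\<close> names them all; its inverse serves as \<open>cl\<close>.\<close>

lemma representation:
  assumes B: "trivial_dca B" and fit: "Pow (elems B) \<lesssim> (UNIV :: 'x set)"
  shows "\<exists>(S :: 'x dms) h. trivial_dms S \<and> t0_space (Xt S) \<and> dm_compact S \<and>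
    dca_iso B (dual_dca S) h"
proof -
  obtain g :: "'a set \<Rightarrow> 'x" where g: "inj_on g (Pow (elems B))"
    using fit unfolding lepoll_def by blast
  have "{\<Gamma>. t_clan B \<Gamma>} \<subseteq> Pow (elems B)"
    unfolding t_clan_def clan_def by blast
  then have "inj_on g {\<Gamma>. t_clan B \<Gamma>}"
    using g inj_on_subset by blast
  then have "bij_betw g {\<Gamma>. t_clan B \<Gamma>} (g ` {\<Gamma>. t_clan B \<Gamma>})"
    by (rule inj_on_imp_bij_betw)
  from bij_betw_inv_into[OF this]
  interpret canonical_space B "g ` {\<Gamma>. t_clan B \<Gamma>}" "inv_into {\<Gamma>. t_clan B \<Gamma>} g"
    using B by unfold_locales
  show ?thesis
    using trivial_dms_dual t0_dual dm_compact_dual iso by blast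
qed

section \<open>The dual equivalence\<close>

text \<open>The dual algebra consists of subsets of the space, whereas the objects of \<open>DCA_trivial K\<close>
  have members of \<open>K\<close> as carriers; it is therefore copied along an arbitrary bijection.\<close>

definition code :: "'a set set \<Rightarrow> 'x dms \<Rightarrow> 'x set \<Rightarrow> 'a" where
  "code K S = (SOME e. \<exists>A\<in>K. bij_betw e (Ms S) A)"

definition coded_dual :: "'a set set \<Rightarrow> 'x dms \<Rightarrow> 'a dca" where
  "coded_dual K S = transport (dual_dca S) (code K S)"

lemma code:
  assumes "S \<in> Ob (DMS_star_trivial K)"
  shows "inj_on (code K S) (Ms S)" "code K S ` Ms S \<in> K"
proof -
  have "\<exists>e. \<exists>A\<in>K. bij_betw e (Ms S) A"
    using assms by (auto simp: eqpoll_def)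
  from someI_ex[OF this] have "\<exists>A\<in>K. bij_betw (code K S) (Ms S) A"
    unfolding code_def .
  then show "inj_on (code K S) (Ms S)" "code K S ` Ms S \<in> K"
    by (auto simp: bij_betw_def)
qed

lemma dca_iso_code:
  assumes "S \<in> Ob (DMS_star_trivial K)"
  shows "dca_iso (dual_dca S) (coded_dual K S) (code K S)"
proof -
  have "is_dca (dual_dca S)"
    using assms by (simp add: is_dca_dual trivial_dms_def)
  then show ?thesis
    unfolding coded_dual_def using code(1)[OF assms] by (simp add: dca_iso_transport)
qed

lemma elems_coded_dual: "elems (coded_dual K S) = code K S ` Ms S"
  by (simp add: coded_dual_def transport_def Let_def)

lemma coded_dual_object:
  assumes "S \<in> Ob (DMS_star_trivial K)"
  shows "coded_dual K S \<in> Ob (DCA_trivial K)"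
proof -
  have "trivial_dca (dual_dca S)"
    using assms by (simp add: dual_trivial)
  then have "trivial_dca (coded_dual K S)"
    by (rule dca_iso.trivial_B[OF dca_iso_code[OF assms]])
  then show ?thesis
    using code(2)[OF assms] by (simp add: DCA_trivial_def elems_coded_dual)
qed

section \<open>Conjugating morphisms by the codes\<close>

definition conjugate :: "'a set set \<Rightarrow> 'x dms \<Rightarrow> 'x dms \<Rightarrow> ('x set \<Rightarrow> 'x set) \<Rightarrow> 'a \<Rightarrow> 'a" where
  "conjugate K S1 S2 f = (\<lambda>u\<in>elems (coded_dual K S1). code K S2 (f (inv_into (Ms S1) (code K S1) u)))"

text \<open>The source is the opposite category, where an arrow from \<open>S2\<close> to
  \<open>S1\<close> is a DMS-morphism from \<open>S1\<close> to \<open>S2\<close>; hence the order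
  of the arguments.\<close>

definition dual_functor :: "'a set set \<Rightarrow> ('x dms, 'x \<Rightarrow> 'x, 'a dca, 'a \<Rightarrow> 'a) fctr" where
  "dual_functor K = \<lparr>obj_map = coded_dual K,
     mor_map = (\<lambda>S2 S1 \<theta>. conjugate K S2 S1 (preimage_map S1 S2 \<theta>))\<rparr>"

context
  fixes K :: "'a set set" and S1 S2 :: "'x dms"
  assumes S: "S1 \<in> Ob (DMS_star_trivial K)" "S2 \<in> Ob (DMS_star_trivial K)"
begin

interpretation S1: dca_iso "dual_dca S1" "coded_dual K S1" "code K S1"
  by (rule dca_iso_code[OF S(1)])

interpretation S2: dca_iso "dual_dca S2" "coded_dual K S2" "code K S2"
  by (rule dca_iso_code[OF S(2)])

lemma conjugate_code: "a \<in> Ms S1 \<Longrightarrow> conjugate K S1 S2 f (code K S1 a) = code K S2 (f a)"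
  using S1.inv_eq by (simp add: conjugate_def elems_coded_dual)

lemma conjugate_eqI:
  assumes "g \<in> extensional (elems (coded_dual K S1))"
    "\<And>a. a \<in> Ms S1 \<Longrightarrow> g (code K S1 a) = code K S2 (f a)"
  shows "conjugate K S1 S2 f = g"
proof (rule extensionalityI)
  fix u assume "u \<in> elems (coded_dual K S1)"
  then show "conjugate K S1 S2 f u = g u"
    using conjugate_code assms(2) by (auto simp: elems_coded_dual)
qed (simp_all add: conjugate_def assms(1))

lemma conjugate_morphism:
  assumes f: "dca_morphism (dual_dca S1) (dual_dca S2) f"
  shows "dca_morphism (coded_dual K S1) (coded_dual K S2) (conjugate K S1 S2 f)"
proof -
  \<comment> \<open>The conjugate written as decoding, \<open>f\<close> and coding, each a
    DCA-morphism.\<close>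
  let ?g = "compose (elems (coded_dual K S1)) (restrict (code K S2) (Ms S2))
    (compose (elems (coded_dual K S1)) f
      (restrict (inv_into (Ms S1) (code K S1)) (elems (coded_dual K S1))))"
  have "f a \<in> Ms S2" if "a \<in> Ms S1" for a
    using f that unfolding dca_morphism_def boolean_hom_def by auto
  then have "conjugate K S1 S2 f = ?g"
    using S1.inv_eq by (intro conjugate_eqI) (auto simp: compose_def elems_coded_dual)
  moreover have "dca_morphism (coded_dual K S1) (coded_dual K S2) ?g"
    using dca_morphism_compose[OF S1.is_dca_B
        dca_morphism_compose[OF S1.is_dca_B S1.inverse_morphism f] S2.morphism] by simp
  ultimately show ?thesis by simp
qed

lemma conjugate_inj:
  assumes f: "dca_morphism (dual_dca S1) (dual_dca S2) f"
    and g: "dca_morphism (dual_dca S1) (dual_dca S2) g"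
    and eq: "conjugate K S1 S2 f = conjugate K S1 S2 g"
  shows "f = g"
proof (rule PiE_ext)
  show f': "f \<in> Ms S1 \<rightarrow>\<^sub>E Ms S2" and g': "g \<in> Ms S1 \<rightarrow>\<^sub>E Ms S2"
    using f g unfolding dca_morphism_def boolean_hom_def by simp_all
  fix a assume a: "a \<in> Ms S1"
  then have "code K S2 (f a) = code K S2 (g a)"
    using arg_cong[OF eq, of "\<lambda>k. k (code K S1 a)"] by (simp add: conjugate_code)
  moreover have "f a \<in> Ms S2" "g a \<in> Ms S2"
    using f' g' a by blast+
  ultimately show "f a = g a"
    using S2.eq_iff[of "f a" "g a"] by simp
qed

lemma conjugate_surj:
  assumes g: "dca_morphism (coded_dual K S1) (coded_dual K S2) g"
  shows "\<exists>f. dca_morphism (dual_dca S1) (dual_dca S2) f \<and> conjugate K S1 S2 f = g"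
proof -
  let ?f = "compose (Ms S1)
    (restrict (inv_into (Ms S2) (code K S2)) (elems (coded_dual K S2)))
    (compose (Ms S1) g (restrict (code K S1) (Ms S1)))"
  have ext: "g \<in> elems (coded_dual K S1) \<rightarrow>\<^sub>E elems (coded_dual K S2)"
    using g unfolding dca_morphism_def boolean_hom_def by blast
  have "conjugate K S1 S2 ?f = g"
  proof (rule conjugate_eqI)
    show "g \<in> extensional (elems (coded_dual K S1))"
      using ext by (simp add: PiE_def)
    fix a assume a: "a \<in> Ms S1"
    then have "g (code K S1 a) \<in> code K S2 ` Ms S2"
      using ext by (auto simp: elems_coded_dual)
    then show "g (code K S1 a) = code K S2 (?f a)"
      using a by (simp add: compose_def elems_coded_dual f_inv_into_f)
  qed
  moreover have "dca_morphism (dual_dca S1) (dual_dca S2) ?f"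
    using dca_morphism_compose[OF S1.A
        dca_morphism_compose[OF S1.A S1.morphism g] S2.inverse_morphism] by simp
  ultimately show ?thesis by blast
qed

end

lemma conjugate_id:
  assumes S: "S \<in> Ob (DMS_star_trivial K)"
  shows "conjugate K S S (\<lambda>a\<in>Ms S. a) = (\<lambda>u\<in>elems (coded_dual K S). u)"
  by (rule conjugate_eqI[OF S S]) (auto simp: elems_coded_dual)

lemma conjugate_compose:
  assumes S: "S1 \<in> Ob (DMS_star_trivial K)" "S2 \<in> Ob (DMS_star_trivial K)"
      "S3 \<in> Ob (DMS_star_trivial K)"
    and f: "dca_morphism (dual_dca S1) (dual_dca S2) f"
  shows "conjugate K S1 S3 (compose (Ms S1) g f) =
    compose (elems (coded_dual K S1)) (conjugate K S2 S3 g) (conjugate K S1 S2 f)"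
proof (rule conjugate_eqI[OF S(1,3)])
  fix a assume a: "a \<in> Ms S1"
  then have "f a \<in> Ms S2"
    using f unfolding dca_morphism_def boolean_hom_def by auto
  then show "compose (elems (coded_dual K S1)) (conjugate K S2 S3 g) (conjugate K S1 S2 f) (code K S1 a)
      = code K S3 (compose (Ms S1) g f a)"
    using a by (simp add: compose_def elems_coded_dual conjugate_code[OF S(1,2)] conjugate_code[OF S(2,3)])
qed (simp add: compose_def)

lemma opposite_simps [simp]:
  "Ob (opposite C) = Ob C" "Hom (opposite C) X Y = Hom C Y X" "Idm (opposite C) = Idm C"
  "Comp (opposite C) X Y Z g f = Comp C Z Y X f g"
  by (simp_all add: opposite_def)

lemma DCA_trivial_simps [simp]:
  "Hom (DCA_trivial K) A B = {f. dca_morphism A B f}"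
  "Idm (DCA_trivial K) A = (\<lambda>x\<in>elems A. x)"
  "Comp (DCA_trivial K) A B C g f = compose (elems A) g f"
  by (simp_all add: DCA_trivial_def)

lemma dual_functor_simps [simp]:
  "obj_map (dual_functor K) S = coded_dual K S"
  "mor_map (dual_functor K) S2 S1 \<theta> = conjugate K S2 S1 (preimage_map S1 S2 \<theta>)"
  by (simp_all add: dual_functor_def)

lemma is_functor_dual_functor:
  "is_functor (opposite (DMS_star_trivial K :: ('x dms, 'x \<Rightarrow> 'x) cat)) (DCA_trivial K)
    (dual_functor K)"
  unfolding is_functor_def opposite_simps dual_functor_simps
proof (intro conjI ballI)
  fix S :: "'x dms" assume S: "S \<in> Ob (DMS_star_trivial K)"
  show "coded_dual K S \<in> Ob (DCA_trivial K)"
    by (rule coded_dual_object[OF S])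
  have "is_dms S" using S by (simp add: trivial_dms_def)
  then show "conjugate K S S (preimage_map S S (Idm (DMS_star_trivial K) S))
      = Idm (DCA_trivial K) (coded_dual K S)"
    by (simp add: preimage_map_id conjugate_id[OF S])
next
  fix S2 S1 :: "'x dms" and \<theta>
  assume S: "S2 \<in> Ob (DMS_star_trivial K)" "S1 \<in> Ob (DMS_star_trivial K)"
    and "\<theta> \<in> Hom (DMS_star_trivial K) S1 S2"
  then have \<theta>: "dms_morphism S1 S2 \<theta>" by simp
  show "conjugate K S2 S1 (preimage_map S1 S2 \<theta>)
      \<in> Hom (DCA_trivial K) (coded_dual K S2) (coded_dual K S1)"
    using conjugate_morphism[OF S preimage_map_morphism[OF \<theta>]] by simp
next
  fix S3 S2 S1 :: "'x dms" and \<eta> \<theta>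
  assume S: "S3 \<in> Ob (DMS_star_trivial K)" "S2 \<in> Ob (DMS_star_trivial K)"
      "S1 \<in> Ob (DMS_star_trivial K)"
    and "\<eta> \<in> Hom (DMS_star_trivial K) S2 S3" "\<theta> \<in> Hom (DMS_star_trivial K) S1 S2"
  then have \<eta>: "dms_morphism S2 S3 \<eta>" and \<theta>: "dms_morphism S1 S2 \<theta>" by simp_all
  show "conjugate K S3 S1 (preimage_map S1 S3 (Comp (DMS_star_trivial K) S1 S2 S3 \<eta> \<theta>)) =
      Comp (DCA_trivial K) (coded_dual K S3) (coded_dual K S2) (coded_dual K S1)
        (conjugate K S2 S1 (preimage_map S1 S2 \<theta>)) (conjugate K S3 S2 (preimage_map S2 S3 \<eta>))"
    by (simp add: preimage_map_compose[OF \<theta> \<eta>]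
        conjugate_compose[OF S preimage_map_morphism[OF \<eta>]])
qed

text \<open>\<open>points_fit\<close> provides room for the t-clans of every admissible algebra and
  enters through essential surjectivity.\<close>

theorem theorem6p15:
  fixes K :: "'a set set"
  assumes points_fit: "\<And>A. A \<in> K \<Longrightarrow> Pow A \<lesssim> (UNIV :: 'x set)"
  shows "dually_equivalent (DCA_trivial K) (DMS_star_trivial K :: ('x dms, 'x \<Rightarrow> 'x) cat)"
proof -
  let ?DMS = "DMS_star_trivial K :: ('x dms, 'x \<Rightarrow> 'x) cat"
  interpret ff_ess_surj "opposite ?DMS" "DCA_trivial K" "dual_functor K"
  proof
    show "is_category (opposite ?DMS)"
      by (intro is_category_opposite is_category_DMS_star_trivial)
    show "is_category (DCA_trivial K)"
      by (rule is_category_DCA_trivial)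
    show "is_functor (opposite ?DMS) (DCA_trivial K) (dual_functor K)"
      by (rule is_functor_dual_functor)
  next
    fix S2 S1 :: "'x dms" and \<theta> \<eta>
    assume "S2 \<in> Ob (opposite ?DMS)" "S1 \<in> Ob (opposite ?DMS)"
      "\<theta> \<in> Hom (opposite ?DMS) S2 S1" "\<eta> \<in> Hom (opposite ?DMS) S2 S1"
      and "mor_map (dual_functor K) S2 S1 \<theta> = mor_map (dual_functor K) S2 S1 \<eta>"
    then have S: "S2 \<in> Ob ?DMS" "S1 \<in> Ob ?DMS"
      and \<theta>: "dms_morphism S1 S2 \<theta>" and \<eta>: "dms_morphism S1 S2 \<eta>"
      and eq: "conjugate K S2 S1 (preimage_map S1 S2 \<theta>) = conjugate K S2 S1 (preimage_map S1 S2 \<eta>)"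
      by (simp_all del: DMS_star_trivial_simps(1))
    have "is_dms S2" "t0_space (Xt S2)"
      using S(1) by (simp_all add: trivial_dms_def)
    then show "\<theta> = \<eta>"
      by (rule preimage_map_inj[OF _ _ \<theta> \<eta>
            conjugate_inj[OF S preimage_map_morphism[OF \<theta>] preimage_map_morphism[OF \<eta>] eq]])
  next
    fix S2 S1 :: "'x dms" and g
    assume "S2 \<in> Ob (opposite ?DMS)" "S1 \<in> Ob (opposite ?DMS)"
      "g \<in> Hom (DCA_trivial K) (obj_map (dual_functor K) S2) (obj_map (dual_functor K) S1)"
    then have S: "S2 \<in> Ob ?DMS" "S1 \<in> Ob ?DMS"
      and g: "dca_morphism (coded_dual K S2) (coded_dual K S1) g"
      by (simp_all del: DMS_star_trivial_simps(1))
    obtain f where f: "dca_morphism (dual_dca S2) (dual_dca S1) f" "conjugate K S2 S1 f = g"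
      using conjugate_surj[OF S g] by blast
    have "is_dms S1" "is_dms S2" "t0_space (Xt S2)" "dm_compact S2"
      using S by (simp_all add: trivial_dms_def)
    then obtain \<theta> where "dms_morphism S1 S2 \<theta>" "preimage_map S1 S2 \<theta> = f"
      using preimage_map_surj[OF _ _ _ _ f(1)] by blast
    then show "\<exists>\<theta>\<in>Hom (opposite ?DMS) S2 S1. mor_map (dual_functor K) S2 S1 \<theta> = g"
      using f(2) by (intro bexI[of _ \<theta>]) simp_all
  next
    fix B :: "'a dca" assume B: "B \<in> Ob (DCA_trivial K)"
    then have "trivial_dca B" and K: "elems B \<in> K"
      by (simp_all add: DCA_trivial_def)
    then obtain S :: "'x dms" and h where S: "trivial_dms S" "t0_space (Xt S)" "dm_compact S"
      and h: "dca_iso B (dual_dca S) h"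
      using representation[OF _ points_fit] by blast
    \<comment> \<open>This puts the representing space into the category: its algebra has the size
      of \<open>elems B\<close>, a member of \<open>K\<close>.\<close>
    have "elems B \<approx> Ms S"
      using dca_iso.bij[OF h] unfolding eqpoll_def by auto
    then have S': "S \<in> Ob ?DMS"
      using S K eqpoll_sym by auto
    then have "dca_iso B (coded_dual K S) (code K S \<circ> h)"
      by (rule dca_iso_comp[OF h dca_iso_code])
    then have "is_iso (DCA_trivial K) B (coded_dual K S) (restrict (code K S \<circ> h) (elems B))"
      by (rule is_iso_DCA_trivial[OF _ B coded_dual_object[OF S']])
    then show "\<exists>S\<in>Ob (opposite ?DMS). \<exists>e. is_iso (DCA_trivial K) B (obj_map (dual_functor K) S) e"
      using S' by (intro bexI[of _ S]) auto
  qed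
  show ?thesis
    \<comment> \<open>The functor runs from the opposite category of spaces to algebras, against the
      direction in the definition, hence the symmetry.\<close>
    unfolding dually_equivalent_def by (rule equivalent_categories_sym) (rule equivalent)
qed

end
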